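(* Let $k$ be an algebraically closed field of characteristic zero, and let $D$ be an irreducible locally nilpotent $k$-derivation of $B=k[x,y,z]$ with $D^2(x)=D^2(y)=0$ that admits a slice $s$ (i.e. $D(s)=1$). Let $N\in\mathbb{Z}\setminus\{0\}$. Then $D$ is conjugate to $\frac{\partial}{\partial z}$, i.e. there is $\phi\in\operatorname{Aut}_k(B)$ with $\phi D\phi^{-1}=\frac{\partial}{\partial z}$, and the $\mathbb{G}_{\mathrm m}$-action on $\mathbb{A}^3=\operatorname{Spec}(B)$ associated with $\partial=NsD$ is linearizable.
   Context: A $k$-derivation $D$ of $B$ is locally nilpotent if for every $b\in B$ there is $m\ge1$ with $D^m(b)=0$; it is irreducible if $D(B)$ is not contained in any proper principal ideal of $B$. With $A=\ker D$, $B=A[s]$ is a polynomial ring in $s$ over $A$, and the action associated with $\partial=NsD$ is $\alpha_t(P(s))=P(t^Ns)$ for $P\in A[T]$, $t\in k^*$. It is called linearizable if there exists $\phi\in\operatorname{Aut}_k(B)$ such that $\phi\partial\phi^{-1}$ is a diagonal linear derivation $\lambda_1x\frac{\partial}{\partial x}+\lambda_2y\frac{\partial}{\partial y}+\lambda_3z\frac{\partial}{\partial z}$, $\lambda_i\in k$. *)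

theory Defs
  imports "HOL-Computational_Algebra.Polynomial"
begin

text \<open>
  The ring \<open>k[x,y,z]\<close> is realised as the iterated polynomial ring \<open>k[x][y][z]\<close>:
  the innermost variable is \<open>x\<close>, the outermost one is \<open>z\<close>.
\<close>

type_synonym 'k poly3 = "'k poly poly poly"

definition const3 :: "'k::zero \<Rightarrow> 'k poly3" where
  "const3 c = [:[:[:c:]:]:]"

definition x3 :: "'k::comm_semiring_1 poly3" where
  "x3 = [:[:[:0, 1:]:]:]"

definition y3 :: "'k::comm_semiring_1 poly3" where
  "y3 = [:[:0, 1:]:]"

definition z3 :: "'k::comm_semiring_1 poly3" where
  "z3 = [:0, 1:]"

definition partial_x :: "'k::idom poly3 \<Rightarrow> 'k poly3" where
  "partial_x = map_poly (map_poly pderiv)"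

definition partial_y :: "'k::idom poly3 \<Rightarrow> 'k poly3" where
  "partial_y = map_poly pderiv"

definition partial_z :: "'k::idom poly3 \<Rightarrow> 'k poly3" where
  "partial_z = pderiv"

definition k_derivation :: "('k::field poly3 \<Rightarrow> 'k poly3) \<Rightarrow> bool" where
  "k_derivation D \<longleftrightarrow>
     (\<forall>a b. D (a + b) = D a + D b) \<and>
     (\<forall>a b. D (a * b) = a * D b + b * D a) \<and>
     (\<forall>c. D (const3 c) = 0)"

definition locally_nilpotent :: "('k::field poly3 \<Rightarrow> 'k poly3) \<Rightarrow> bool" where
  "locally_nilpotent D \<longleftrightarrow> (\<forall>b. \<exists>m\<ge>1. (D ^^ m) b = 0)"

text \<open>The principal ideal generated by \<open>f\<close> is proper iff \<open>f\<close> is not a unit.\<close>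

definition irreducible_derivation :: "('k::field poly3 \<Rightarrow> 'k poly3) \<Rightarrow> bool" where
  "irreducible_derivation D \<longleftrightarrow> (\<forall>f. (\<forall>b. f dvd D b) \<longrightarrow> f dvd 1)"

definition k_automorphism :: "('k::field poly3 \<Rightarrow> 'k poly3) \<Rightarrow> bool" where
  "k_automorphism \<phi> \<longleftrightarrow>
     bij \<phi> \<and>
     (\<forall>a b. \<phi> (a + b) = \<phi> a + \<phi> b) \<and>
     (\<forall>a b. \<phi> (a * b) = \<phi> a * \<phi> b) \<and>
     (\<forall>c. \<phi> (const3 c) = const3 c)"

definition conjugate_derivations ::
  "('k::field poly3 \<Rightarrow> 'k poly3) \<Rightarrow> ('k poly3 \<Rightarrow> 'k poly3) \<Rightarrow> bool" where
  "conjugate_derivations D E \<longleftrightarrow>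
     (\<exists>\<phi>. k_automorphism \<phi> \<and> \<phi> \<circ> D \<circ> inv \<phi> = E)"

definition diagonal_derivation :: "'k::field \<Rightarrow> 'k \<Rightarrow> 'k \<Rightarrow> 'k poly3 \<Rightarrow> 'k poly3" where
  "diagonal_derivation l1 l2 l3 b =
     const3 l1 * x3 * partial_x b + const3 l2 * y3 * partial_y b + const3 l3 * z3 * partial_z b"

text \<open>
  A family \<open>\<alpha>\<close> of self-maps of \<open>B = k[x,y,z]\<close>, considered for \<open>t \<noteq> 0\<close> only, is an algebraic
  action of the multiplicative group with associated derivation \<open>\<delta>\<close>: the coaction
  \<open>b \<mapsto> (\<Sum>n. c\<^sub>n T\<^sup>n)\<close> with values in \<open>B[T, 1/T]\<close> describes \<open>\<alpha>\<close>, and \<open>\<delta> b\<close> is its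
  derivative with respect to \<open>T\<close> at \<open>T = 1\<close>.  That \<open>\<alpha> 1\<close> is the identity follows from the
  first two clauses.
\<close>

definition Gm_action_of_derivation ::
  "('k::field \<Rightarrow> 'k poly3 \<Rightarrow> 'k poly3) \<Rightarrow> ('k poly3 \<Rightarrow> 'k poly3) \<Rightarrow> bool" where
  "Gm_action_of_derivation \<alpha> \<delta> \<longleftrightarrow>
     (\<forall>t. t \<noteq> 0 \<longrightarrow> k_automorphism (\<alpha> t)) \<and>
     (\<forall>t u. t \<noteq> 0 \<longrightarrow> u \<noteq> 0 \<longrightarrow> \<alpha> (t * u) = \<alpha> t \<circ> \<alpha> u) \<and>
     (\<forall>b. \<exists>(F::int set) c. finite F \<and>
        (\<forall>t. t \<noteq> 0 \<longrightarrow> \<alpha> t b = (\<Sum>n\<in>F. const3 (t powi n) * c n)) \<and>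
        \<delta> b = (\<Sum>n\<in>F. of_int n * c n))"

definition linearizable_Gm_action ::
  "('k::field \<Rightarrow> 'k poly3 \<Rightarrow> 'k poly3) \<Rightarrow> ('k poly3 \<Rightarrow> 'k poly3) \<Rightarrow> bool" where
  "linearizable_Gm_action \<alpha> \<delta> \<longleftrightarrow>
     Gm_action_of_derivation \<alpha> \<delta> \<and>
     (\<exists>l1 l2 l3. conjugate_derivations \<delta> (diagonal_derivation l1 l2 l3))"

text \<open>
  For a locally nilpotent derivation \<open>D\<close> with slice \<open>s\<close> in characteristic zero, every \<open>b\<close> is
  \<open>P(s)\<close> for exactly one polynomial \<open>P\<close> with coefficients in the kernel \<open>A\<close> of \<open>D\<close>;
  the map below is \<open>P(s) \<mapsto> P(t\<^sup>N s)\<close>.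
\<close>

definition slice_action ::
  "('k::field poly3 \<Rightarrow> 'k poly3) \<Rightarrow> 'k poly3 \<Rightarrow> int \<Rightarrow> 'k \<Rightarrow> 'k poly3 \<Rightarrow> 'k poly3" where
  "slice_action D s N t b =
     poly (THE P. (\<forall>i. D (coeff P i) = 0) \<and> poly P s = b) (const3 (t powi N) * s)"

end

theory Submission
  imports Defs
begin

text \<open>
  By the slice theorem, \<open>B = A[s]\<close> with \<open>A = ker D\<close>.  So it suffices to show \<open>A = k[a,b]\<close> with
  \<open>a\<close>, \<open>b\<close> algebraically independent: then \<open>x, y, z \<mapsto> a, b, s\<close> is an automorphism which
  carries \<open>\<partial>/\<partial>z\<close> to \<open>D\<close> and \<open>z\<close> to \<open>s\<close>, hence \<open>N z \<partial>/\<partial>z\<close> to \<open>N s D\<close>, and the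
  latter is linearized.  That \<open>A\<close> is a polynomial ring is a deep theorem in general; here it
  follows by elementary means from the geometry of the orbits of the additive group action with
  velocity \<open>D\<close>.

  Write \<open>f = D x\<close>, \<open>g = D y\<close>, \<open>h = D z\<close>.  As \<open>f\<close> and \<open>g\<close> are constants of \<open>D\<close>, the orbit of
  a point projects to a straight line in the \<open>(x,y)\<close>-plane, run through with constant velocity
  \<open>(f, g)\<close>; where \<open>f\<close> and \<open>g\<close> vanish, the orbit is the whole vertical line
  (\<open>vertical_orbit\<close>).  The first aim is a coordinate system whose first variable is a constant
  of \<open>D\<close>, while \<open>D\<^sup>2\<close> still annihilates the second one.

  If \<open>f\<close> and \<open>g\<close> are linearly dependent over \<open>k\<close>, a linear form in \<open>x\<close> and \<open>y\<close> is such a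
  first variable.  Suppose that they are independent, let \<open>n\<close> be the larger of their degrees in
  \<open>z\<close> and let \<open>F\<close>, \<open>G\<close> be their coefficients of \<open>z\<^sup>n\<close>.  The direction \<open>f : g\<close> is not a function of
  \<open>(x,y)\<close> alone (\<open>dependent_if_direction_in_xy\<close>).  So over a generic point of the plane there
  are exactly \<open>n\<close> points with a given generic direction, namely the roots in \<open>z\<close> of a pencil
  member \<open>g(p) f - f(p) g\<close>.  The orbits through these \<open>n\<close> points lie over the same line and
  never meet.  Over an algebraically closed field a polynomial without zeros is constant, so along
  the line the differences of the roots, and the leading coefficient of the pencil member as
  well, are constant (\<open>pencil_along_orbit\<close>).  The constancy of the leading coefficient yields
  \<open>(F, G) = c (x, y) + const\<close>, and \<open>c = 0\<close> because \<open>D\<close> is locally nilpotent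
  (\<open>lead_coeffs_constant\<close>).  The constancy of the root differences determines \<open>h\<close> through the
  sum of the roots, and a comparison of degrees in \<open>z\<close> gives \<open>D(z + v) = 0\<close> for some
  \<open>v \<in> k[x,y]\<close> (\<open>kernel_coordinate\<close>); the coordinates \<open>z + v, y, x\<close> serve the purpose.

  So let \<open>D x = 0\<close> and \<open>D\<^sup>2 y = 0\<close>.  If \<open>g = 0\<close>, then \<open>A = k[x,y]\<close>.  Otherwise, a zero of
  \<open>g\<close> spreads along the vertical line through it, so \<open>g\<close> is constant on every vertical line;
  with \<open>D g = 0\<close> this puts \<open>g\<close> into \<open>k[x]\<close>, and local nilpotency forces \<open>h\<close> into \<open>k[x,y]\<close>.
  The kernel then contains an element \<open>w = r(x) z - H(x,y)\<close> with \<open>r \<noteq> 0\<close>, and for \<open>r\<close> of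
  least degree \<open>A = k[x,w]\<close> (\<open>kernel_polynomial_ring\<close>).
\<close>

section \<open>Ring homomorphisms and derivations on polynomial rings\<close>

definition ring_homo :: "('a::comm_ring_1 \<Rightarrow> 'b::comm_ring_1) \<Rightarrow> bool" where
  "ring_homo h \<longleftrightarrow>
     (\<forall>a b. h (a + b) = h a + h b) \<and> (\<forall>a b. h (a * b) = h a * h b) \<and> h 1 = 1"

lemma ring_homo_add: "ring_homo h \<Longrightarrow> h (a + b) = h a + h b"
  and ring_homo_mult: "ring_homo h \<Longrightarrow> h (a * b) = h a * h b"
  and ring_homo_1: "ring_homo h \<Longrightarrow> h 1 = 1"
  by (auto simp: ring_homo_def)

lemma ring_homo_0: "ring_homo h \<Longrightarrow> h 0 = 0"
  using ring_homo_add[of h 0 0] by simp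

lemma ring_homo_minus: "ring_homo h \<Longrightarrow> h (- a) = - h a"
  using ring_homo_add[of h a "- a"] ring_homo_0[of h] by (simp add: minus_unique)

lemma ring_homo_diff: "ring_homo h \<Longrightarrow> h (a - b) = h a - h b"
  using ring_homo_add[of h a "- b"] ring_homo_minus[of h b] by simp

lemma ring_homo_power: "ring_homo h \<Longrightarrow> h (a ^ n) = h a ^ n"
  by (induction n) (auto simp: ring_homo_1 ring_homo_mult)

lemma ring_homo_of_nat: "ring_homo h \<Longrightarrow> h (of_nat n) = of_nat n"
  by (induction n) (auto simp: ring_homo_0 ring_homo_1 ring_homo_add)

lemma ring_homo_prod: "ring_homo h \<Longrightarrow> h (\<Prod>i\<in>I. f i) = (\<Prod>i\<in>I. h (f i))"
  by (induction I rule: infinite_finite_induct) (auto simp: ring_homo_1 ring_homo_mult)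

lemmas ring_homo_simps =
  ring_homo_add ring_homo_mult ring_homo_1 ring_homo_0 ring_homo_minus ring_homo_diff
  ring_homo_power ring_homo_of_nat

lemma ring_homo_comp: "ring_homo g \<Longrightarrow> ring_homo h \<Longrightarrow> ring_homo (\<lambda>x. g (h x))"
  by (auto simp: ring_homo_def)

lemma ring_homo_id: "ring_homo (\<lambda>x. x)"
  by (auto simp: ring_homo_def)

lemma ring_homo_const_poly: "ring_homo (\<lambda>c. [:c:])"
  by (auto simp: ring_homo_def)

lemma ring_homo_inv:
  assumes "ring_homo h" "bij h"
  shows "ring_homo (inv h)"
proof -
  have e: "inv h b = a \<longleftrightarrow> h a = b" for a b
    using bij_inv_eq_iff[OF assms(2)] by metis
  have i: "h (inv h b) = b" for b
    using e by blast
  show ?thesis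
    using assms(1) by (simp add: ring_homo_def e i)
qed

definition extend :: "('a::comm_ring_1 \<Rightarrow> 'b::comm_ring_1) \<Rightarrow> 'b \<Rightarrow> 'a poly \<Rightarrow> 'b" where
  "extend h r p = poly (map_poly h p) r"

lemma extend_pCons:
  "ring_homo h \<Longrightarrow> extend h r (pCons c p) = h c + r * extend h r p"
  by (simp add: extend_def map_poly_pCons ring_homo_0)

lemma extend_0: "extend h r 0 = 0"
  by (simp add: extend_def)

lemma extend_const: "ring_homo h \<Longrightarrow> extend h r [:c:] = h c"
  by (simp add: extend_pCons extend_0)

lemma extend_var: "ring_homo h \<Longrightarrow> extend h r [:0, 1:] = r"
  by (simp add: extend_pCons extend_0 ring_homo_simps)

lemma ring_homo_extend:
  assumes h: "ring_homo h"
  shows "ring_homo (extend h r)"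
proof -
  have add: "extend h r (p + q) = extend h r p + extend h r q" for p q
    by (induction p q rule: poly_induct2)
      (auto simp: extend_pCons extend_0 h ring_homo_simps algebra_simps)
  have smult: "extend h r (smult c q) = h c * extend h r q" for c q
    by (induction q) (auto simp: extend_pCons extend_0 h ring_homo_simps algebra_simps)
  have "extend h r (p * q) = extend h r p * extend h r q" for p q
    by (induction p)
      (auto simp: extend_pCons extend_0 h ring_homo_simps add smult algebra_simps)
  moreover have "extend h r 1 = 1"
    using extend_const[OF h, of r 1] by (simp add: ring_homo_1[OF h] one_pCons)
  ultimately show ?thesis
    using add by (auto simp: ring_homo_def)
qed

lemma ring_homo_poly_eqI:
  assumes "ring_homo \<phi>" "ring_homo \<psi>" "\<And>c. \<phi> [:c:] = \<psi> [:c:]" "\<phi> [:0, 1:] = \<psi> [:0, 1:]"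
  shows "\<phi> p = \<psi> p"
proof (induction p)
  case (pCons c p)
  have e: "pCons c p = [:c:] + [:0, 1:] * p"
    by simp
  show ?case
    unfolding e ring_homo_add[OF assms(1)] ring_homo_add[OF assms(2)]
      ring_homo_mult[OF assms(1)] ring_homo_mult[OF assms(2)]
    by (simp only: pCons.IH assms(3,4))
qed (use assms in \<open>simp add: ring_homo_0\<close>)

lemma xy_homo_eqI:
  assumes "ring_homo \<phi>" "ring_homo \<psi>" "\<And>c. \<phi> (const3 c) = \<psi> (const3 c)"
    and "\<phi> x3 = \<psi> x3" "\<phi> y3 = \<psi> y3"
  shows "\<phi> [:q:] = \<psi> [:q:]"
proof -
  note h = ring_homo_comp[OF _ ring_homo_const_poly]
  have 1: "\<phi> [:[:r:]:] = \<psi> [:[:r:]:]" for r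
  proof (rule ring_homo_poly_eqI[OF h[OF h[OF assms(1)]] h[OF h[OF assms(2)]]])
    show "\<phi> [:[:[:c:]:]:] = \<psi> [:[:[:c:]:]:]" for c
      using assms(3)[of c] unfolding const3_def .
    show "\<phi> [:[:[:0, 1:]:]:] = \<psi> [:[:[:0, 1:]:]:]"
      using assms(4) unfolding x3_def .
  qed
  show ?thesis
  proof (rule ring_homo_poly_eqI[OF h[OF assms(1)] h[OF assms(2)]])
    show "\<phi> [:[:0, 1:]:] = \<psi> [:[:0, 1:]:]"
      using assms(5) unfolding y3_def .
  qed (rule 1)
qed

lemma poly3_homo_eqI:
  assumes "ring_homo \<phi>" "ring_homo \<psi>" "\<And>c. \<phi> (const3 c) = \<psi> (const3 c)"
    and "\<phi> x3 = \<psi> x3" "\<phi> y3 = \<psi> y3" "\<phi> z3 = \<psi> z3"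
  shows "\<phi> p = \<psi> p"
proof (rule ring_homo_poly_eqI[OF assms(1,2)])
  show "\<phi> [:q:] = \<psi> [:q:]" for q
    by (rule xy_homo_eqI[OF assms(1-5)])
  show "\<phi> [:0, 1:] = \<psi> [:0, 1:]"
    using assms(6) unfolding z3_def .
qed

lemma ring_homo_const3: "ring_homo const3"
  unfolding const3_def
  by (rule ring_homo_comp[OF ring_homo_comp[OF ring_homo_const_poly ring_homo_const_poly]
      ring_homo_const_poly])

text \<open>The universal property of the polynomial ring in three variables.\<close>

definition eval3 ::
  "('k::comm_ring_1 \<Rightarrow> 'b::comm_ring_1) \<Rightarrow> 'b \<Rightarrow> 'b \<Rightarrow> 'b \<Rightarrow> 'k poly3 \<Rightarrow> 'b" where
  "eval3 h a b c = extend (extend (extend h a) b) c"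

lemma ring_homo_eval3: "ring_homo h \<Longrightarrow> ring_homo (eval3 h a b c)"
  unfolding eval3_def by (intro ring_homo_extend)

lemma eval3_gens:
  assumes "ring_homo h"
  shows "eval3 h a b c (const3 k) = h k" "eval3 h a b c x3 = a" "eval3 h a b c y3 = b"
    "eval3 h a b c z3 = c"
  using assms
  by (simp_all add: eval3_def const3_def x3_def y3_def z3_def extend_const extend_var
      ring_homo_extend)

definition derivation :: "('a::comm_ring_1 \<Rightarrow> 'a) \<Rightarrow> bool" where
  "derivation \<delta> \<longleftrightarrow>
     (\<forall>a b. \<delta> (a + b) = \<delta> a + \<delta> b) \<and> (\<forall>a b. \<delta> (a * b) = a * \<delta> b + b * \<delta> a)"

lemma derivation_add: "derivation \<delta> \<Longrightarrow> \<delta> (a + b) = \<delta> a + \<delta> b"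
  and derivation_mult: "derivation \<delta> \<Longrightarrow> \<delta> (a * b) = a * \<delta> b + b * \<delta> a"
  by (auto simp: derivation_def)

lemma derivation_0: "derivation \<delta> \<Longrightarrow> \<delta> 0 = 0"
  using derivation_add[of \<delta> 0 0] by simp

lemma derivation_minus: "derivation \<delta> \<Longrightarrow> \<delta> (- a) = - \<delta> a"
  using derivation_add[of \<delta> a "- a"] derivation_0[of \<delta>] by (simp add: minus_unique)

lemma derivation_diff: "derivation \<delta> \<Longrightarrow> \<delta> (a - b) = \<delta> a - \<delta> b"
  using derivation_add[of \<delta> a "- b"] derivation_minus[of \<delta> b] by simp

lemma derivation_1: "derivation \<delta> \<Longrightarrow> \<delta> 1 = 0"
  using derivation_mult[of \<delta> 1 1] by simp

lemma derivation_sum: "derivation \<delta> \<Longrightarrow> \<delta> (\<Sum>i\<in>I. f i) = (\<Sum>i\<in>I. \<delta> (f i))"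
  by (induction I rule: infinite_finite_induct) (auto simp: derivation_0 derivation_add)

lemmas derivation_simps =
  derivation_add derivation_mult derivation_0 derivation_minus derivation_diff derivation_1

lemma derivation_map_poly:
  assumes "derivation \<delta>"
  shows "derivation (map_poly \<delta>)"
proof -
  note d = derivation_simps[OF assms] derivation_sum[OF assms]
  have c: "coeff (map_poly \<delta> p) n = \<delta> (coeff p n)" for p n
    by (simp add: coeff_map_poly d)
  have "map_poly \<delta> (p * q) = p * map_poly \<delta> q + q * map_poly \<delta> p" for p q
  proof (rule poly_eqI)
    fix n
    have "coeff (map_poly \<delta> (p * q)) n =
        (\<Sum>i\<le>n. coeff p i * \<delta> (coeff q (n - i)) + \<delta> (coeff p i) * coeff q (n - i))"
      by (simp add: c coeff_mult d algebra_simps)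
    also have "\<dots> = coeff (p * map_poly \<delta> q + map_poly \<delta> p * q) n"
      by (simp add: c coeff_mult sum.distrib)
    finally show "coeff (map_poly \<delta> (p * q)) n = coeff (p * map_poly \<delta> q + q * map_poly \<delta> p) n"
      by (simp add: mult.commute)
  qed
  then show ?thesis
    by (auto simp: derivation_def c d intro!: poly_eqI)
qed

lemma derivation_pderiv: "derivation pderiv"
  by (auto simp: derivation_def pderiv_add pderiv_mult)

lemma derivation_poly_eqI:
  assumes "derivation \<delta>" "derivation \<epsilon>" "ring_homo e"
    and "\<And>c. \<delta> (e [:c:]) = \<epsilon> (e [:c:])" "\<delta> (e [:0, 1:]) = \<epsilon> (e [:0, 1:])"
  shows "\<delta> (e p) = \<epsilon> (e p)"
proof (induction p)
  case (pCons c p)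
  have e: "pCons c p = [:c:] + [:0, 1:] * p"
    by simp
  show ?case
    unfolding e ring_homo_add[OF assms(3)] ring_homo_mult[OF assms(3)]
      derivation_add[OF assms(1)] derivation_add[OF assms(2)]
      derivation_mult[OF assms(1)] derivation_mult[OF assms(2)]
    by (simp only: pCons.IH assms(4,5))
qed (use assms in \<open>simp add: ring_homo_0 derivation_0\<close>)

lemma partial_gens:
  "partial_x (const3 c) = 0" "partial_y (const3 c) = 0" "partial_z (const3 c) = 0"
  "partial_x x3 = 1" "partial_y x3 = 0" "partial_z x3 = 0"
  "partial_x y3 = 0" "partial_y y3 = 1" "partial_z y3 = 0"
  "partial_x z3 = 0" "partial_y z3 = 0" "partial_z z3 = 1"
  by (simp_all add: partial_x_def partial_y_def partial_z_def const3_def x3_def y3_def z3_def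
      map_poly_pCons pderiv_pCons one_pCons)

text \<open>The chain rule: a derivation of \<open>k[x,y,z]\<close> over \<open>k\<close> is a vector field.\<close>

lemma k_derivation_expand:
  assumes "k_derivation D"
  shows "D b = partial_x b * D x3 + partial_y b * D y3 + partial_z b * D z3"
proof -
  define E where "E b = partial_x b * D x3 + partial_y b * D y3 + partial_z b * D z3" for b
  have D: "derivation D" "\<And>c. D (const3 c) = 0"
    using assms by (auto simp: k_derivation_def derivation_def)
  have "derivation (partial_x :: 'a poly3 \<Rightarrow> _)" "derivation (partial_y :: 'a poly3 \<Rightarrow> _)"
    "derivation (partial_z :: 'a poly3 \<Rightarrow> _)"
    unfolding partial_x_def partial_y_def partial_z_def
    by (intro derivation_map_poly derivation_pderiv)+
  then have E: "derivation E"
    unfolding E_def derivation_def by (auto simp: algebra_simps)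
  have E_gens: "E (const3 c) = 0" "E x3 = D x3" "E y3 = D y3" "E z3 = D z3" for c
    by (simp_all add: E_def partial_gens)
  note c = ring_homo_const_poly
  have D1: "D [:[:r:]:] = E [:[:r:]:]" for r
  proof (rule derivation_poly_eqI[OF D(1) E ring_homo_comp[OF c c]])
    show "D [:[:[:k:]:]:] = E [:[:[:k:]:]:]" for k
      using D(2) E_gens(1) unfolding const3_def by metis
    show "D [:[:[:0, 1:]:]:] = E [:[:[:0, 1:]:]:]"
      using E_gens(2) unfolding x3_def by metis
  qed
  have D2: "D [:q:] = E [:q:]" for q
  proof (rule derivation_poly_eqI[OF D(1) E c])
    show "D [:[:0, 1:]:] = E [:[:0, 1:]:]"
      using E_gens(3) unfolding y3_def by metis
  qed (rule D1)
  have "D b = E b"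
  proof (rule derivation_poly_eqI[OF D(1) E ring_homo_id])
    show "D [:0, 1:] = E [:0, 1:]"
      using E_gens(4) unfolding z3_def by metis
  qed (rule D2)
  then show ?thesis
    by (simp add: E_def)
qed

lemma antiderivative_exists:
  fixes Q :: "'a::idom poly" and \<iota> :: "nat \<Rightarrow> 'a"
  assumes "\<And>n. \<iota> n * of_nat (Suc n) = 1"
  shows "\<exists>P. pderiv P = Q \<and> (\<forall>n. coeff P (Suc n) = \<iota> n * coeff Q n) \<and> coeff P 0 = 0"
proof -
  define P where "P = pCons 0 (Poly (map (\<lambda>n. \<iota> n * coeff Q n) [0..<Suc (degree Q)]))"
  have P: "coeff P (Suc n) = \<iota> n * coeff Q n" "coeff P 0 = 0" for n
    by (auto simp: P_def nth_default_def coeff_eq_0 simp del: upt_Suc)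
  have "of_nat (Suc n) * (\<iota> n * coeff Q n) = coeff Q n" for n
    using assms[of n] by (metis mult.assoc mult.commute mult_1)
  then have "pderiv P = Q"
    by (intro poly_eqI) (simp only: coeff_pderiv P)
  then show ?thesis
    using P by blast
qed

section \<open>Evaluation at points of affine space\<close>

lemma ring_homo_poly: "ring_homo (\<lambda>P. poly P t)"
  by (auto simp: ring_homo_def)

lemma ring_homo_apply_poly: "ring_homo h \<Longrightarrow> h (poly P r) = extend h (h r) P"
  by (induction P) (auto simp: extend_pCons extend_0 ring_homo_simps)

lemma extend_comp: "ring_homo g \<Longrightarrow> ring_homo h \<Longrightarrow> g (extend h r P) = extend (\<lambda>c. g (h c)) (g r) P"
  by (induction P) (auto simp: extend_pCons extend_0 ring_homo_simps ring_homo_comp)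

lemma extend_cong: "(\<And>i. h (coeff P i) = h' (coeff P i)) \<Longrightarrow> extend h r P = extend h' r P"
proof -
  assume "\<And>i. h (coeff P i) = h' (coeff P i)"
  then have "map_poly h P = map_poly h' P"
    by (intro map_poly_cong) (auto simp: coeffs_def simp del: upt_Suc split: if_splits)
  then show ?thesis
    by (simp add: extend_def)
qed

definition ev2 :: "'k::comm_ring_1 \<Rightarrow> 'k \<Rightarrow> 'k poly poly \<Rightarrow> 'k" where
  "ev2 a b = extend (extend (\<lambda>x. x) a) b"

definition fibre :: "'k::comm_ring_1 \<Rightarrow> 'k \<Rightarrow> 'k poly3 \<Rightarrow> 'k poly" where
  "fibre a b = map_poly (ev2 a b)"

definition ev :: "'k::comm_ring_1 \<times> 'k \<times> 'k \<Rightarrow> 'k poly3 \<Rightarrow> 'k" where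
  "ev p = eval3 (\<lambda>x. x) (fst p) (fst (snd p)) (snd (snd p))"

lemma ring_homo_ev2: "ring_homo (ev2 a b)"
  unfolding ev2_def by (intro ring_homo_extend ring_homo_id)

lemma ring_homo_ev: "ring_homo (ev p)"
  unfolding ev_def by (intro ring_homo_eval3 ring_homo_id)

lemmas ev_simps = ring_homo_simps[OF ring_homo_ev]
lemmas ev2_simps = ring_homo_simps[OF ring_homo_ev2]

lemma ev_gens: "ev p (const3 k) = k" "ev p x3 = fst p" "ev p y3 = fst (snd p)"
    "ev p z3 = snd (snd p)"
  by (simp_all add: ev_def eval3_gens ring_homo_id)

lemma ev_fibre: "ev (a, b, c) u = poly (fibre a b u) c"
  by (simp add: ev_def eval3_def ev2_def fibre_def extend_def)

lemma coeff_fibre: "coeff (fibre a b u) i = ev2 a b (coeff u i)"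
  by (simp add: fibre_def coeff_map_poly ev2_simps)

lemma ev_const: "ev (a, b, c) [:F:] = ev2 a b F"
  by (simp add: ev_fibre fibre_def map_poly_pCons ev2_simps)

lemma ev2_const: "ev2 a b [:r:] = poly r a"
  by (simp add: ev2_def extend_const ring_homo_extend ring_homo_id) (simp add: extend_def)

lemma ev2_all_0:
  fixes F :: "'k::{idom, ring_char_0} poly poly"
  assumes "\<And>a b. ev2 a b F = 0"
  shows "F = 0"
proof (rule poly_eqI)
  fix i
  have "map_poly (\<lambda>r. poly r a) F = 0" for a
  proof -
    have "poly (map_poly (\<lambda>r. poly r a) F) b = 0" for b
      using assms[of a b] by (simp add: ev2_def extend_def[abs_def])
    then show ?thesis
      using poly_all_0_iff_0 by blast
  qed
  then have "coeff (map_poly (\<lambda>r. poly r a) F) i = 0" for a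
    by simp
  then have "poly (coeff F i) a = 0" for a
    by (simp add: coeff_map_poly)
  then have "coeff F i = 0"
    using poly_all_0_iff_0 by blast
  then show "coeff F i = coeff 0 i"
    by simp
qed

lemma ev_all_0:
  fixes u :: "'k::{idom, ring_char_0} poly3"
  assumes "\<And>p. ev p u = 0"
  shows "u = 0"
proof (rule poly_eqI)
  fix i
  have "fibre a b u = 0" for a b
  proof -
    have "poly (fibre a b u) c = 0" for c
      using assms[of "(a, b, c)"] by (simp add: ev_fibre)
    then show ?thesis
      using poly_all_0_iff_0 by blast
  qed
  then have "coeff (fibre a b u) i = 0" for a b
    by simp
  then have "coeff u i = 0"
    by (intro ev2_all_0) (simp add: coeff_fibre)
  then show "coeff u i = coeff 0 i"
    by simp
qed

lemma ev_nonzero_point: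
  fixes u :: "'k::{idom, ring_char_0} poly3"
  assumes "u \<noteq> 0"
  obtains p where "ev p u \<noteq> 0"
  using ev_all_0 assms by blast

text \<open>Zariski density of the complement of a hypersurface.\<close>

lemma ev_dense_0:
  fixes u v :: "'k::{idom, ring_char_0} poly3"
  assumes "v \<noteq> 0" "\<And>p. ev p v \<noteq> 0 \<Longrightarrow> ev p u = 0"
  shows "u = 0"
proof -
  have "ev p (u * v) = 0" for p
    using assms(2)[of p] by (auto simp: ev_simps)
  then have "u * v = 0"
    by (rule ev_all_0)
  then show ?thesis
    using assms(1) by simp
qed

lemma poly_surj_alg_closed:
  fixes P :: "'k::alg_closed_field poly"
  assumes "degree P > 0"
  obtains t where "poly P t = c"
proof -
  have "degree (P - [:c:]) > 0"
    using assms by (cases P) (auto split: if_splits)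
  then obtain t where "poly (P - [:c:]) t = 0"
    using alg_closed_imp_poly_has_root by blast
  then show ?thesis
    by (intro that[of t]) simp
qed

section \<open>Locally nilpotent derivations with a slice\<close>

locale slice_derivation =
  fixes D :: "'k::{alg_closed_field, field_char_0} poly3 \<Rightarrow> 'k poly3" and s :: "'k poly3"
  assumes k_der: "k_derivation D"
    and loc_nilp: "locally_nilpotent D"
    and slice: "D s = 1"
begin

lemma der: "derivation D"
  using k_der by (auto simp: k_derivation_def derivation_def)

lemmas D_simps = derivation_simps[OF der]
lemmas D_expand = k_derivation_expand[OF k_der]

lemma D_const3: "D (const3 c) = 0"
  using k_der by (auto simp: k_derivation_def)

lemma D_of_nat: "D (of_nat n) = 0"
  by (induction n) (auto simp: D_simps)

definition over_ker :: "'k poly3 poly \<Rightarrow> bool" where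
  "over_ker P \<longleftrightarrow> (\<forall>i. D (coeff P i) = 0)"

lemma over_ker_pCons: "over_ker (pCons c P) \<longleftrightarrow> D c = 0 \<and> over_ker P"
  unfolding over_ker_def by (auto simp: coeff_pCons split: nat.splits)

lemma over_ker_0: "over_ker 0"
  by (simp add: over_ker_def D_simps)

lemma over_ker_add: "over_ker P \<Longrightarrow> over_ker Q \<Longrightarrow> over_ker (P + Q)"
  by (simp add: over_ker_def D_simps)

lemma over_ker_mult: "over_ker P \<Longrightarrow> over_ker Q \<Longrightarrow> over_ker (P * Q)"
  by (simp add: over_ker_def coeff_mult derivation_sum[OF der] D_simps)

lemma over_ker_pderiv: "over_ker P \<Longrightarrow> over_ker (pderiv P)"
  by (simp add: over_ker_def coeff_pderiv D_simps D_of_nat del: of_nat_Suc)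

lemma D_poly_slice: "over_ker P \<Longrightarrow> D (poly P s) = poly (pderiv P) s"
  by (induction P) (auto simp: over_ker_pCons D_simps slice pderiv_pCons)

text \<open>
  If \<open>D b\<close> is a polynomial in the slice, then integrating that polynomial gives one which
  differs from \<open>b\<close> by a constant of \<open>D\<close> only; local nilpotency starts the induction.
\<close>

lemma slice_expansion_exists: "\<exists>P. over_ker P \<and> poly P s = b"
proof -
  obtain m where "(D ^^ m) b = 0"
    using loc_nilp by (auto simp: locally_nilpotent_def)
  then show ?thesis
  proof (induction m arbitrary: b)
    case 0
    then show ?case
      using over_ker_0 by (intro exI[of _ 0]) simp
  next
    case (Suc m)
    then have "(D ^^ m) (D b) = 0"
      by (simp add: funpow_swap1)
    then obtain Q where Q: "over_ker Q" "poly Q s = D b"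
      using Suc.IH by blast
    define \<iota> :: "nat \<Rightarrow> 'k poly3" where "\<iota> n = const3 (1 / of_nat (Suc n))" for n
    have "\<iota> n * of_nat (Suc n) = 1" for n
    proof -
      have "\<iota> n * of_nat (Suc n) = const3 (1 / of_nat (Suc n) * of_nat (Suc n))"
        unfolding \<iota>_def by (simp only: ring_homo_mult[OF ring_homo_const3]
            ring_homo_of_nat[OF ring_homo_const3])
      also have "\<dots> = 1"
        by (simp add: ring_homo_1[OF ring_homo_const3] del: of_nat_Suc)
      finally show ?thesis .
    qed
    then obtain P where P: "pderiv P = Q" "\<And>n. coeff P (Suc n) = \<iota> n * coeff Q n"
      "coeff P 0 = 0"
      using antiderivative_exists[of \<iota> Q] by blast
    have "D (coeff P n) = 0" for n
      using P Q by (cases n) (auto simp: \<iota>_def D_simps D_const3 over_ker_def)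
    then have kP: "over_ker P"
      by (simp add: over_ker_def)
    have "D (b - poly P s) = 0"
      using D_poly_slice[OF kP] P Q by (simp add: D_simps)
    then show ?case
      using kP by (intro exI[of _ "P + [:b - poly P s:]"])
        (auto intro!: over_ker_add simp: over_ker_pCons over_ker_0)
  qed
qed

text \<open>
  Applying \<open>D\<close> differentiates a relation for the slice and so lowers its degree.
\<close>

lemma slice_transcendental:
  assumes "over_ker P" "poly P s = 0"
  shows "P = 0"
  using assms
proof (induction "degree P" arbitrary: P rule: less_induct)
  case less
  have "poly (pderiv P) s = 0"
    using D_poly_slice[OF less.prems(1)] less.prems(2) by (simp add: D_simps)
  then have "pderiv P = 0"
    using less.hyps[of "pderiv P"] less.prems over_ker_pderiv
    by (cases "degree P = 0") (auto simp: pderiv_eq_0_iff degree_pderiv)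
  then show ?case
    using less.prems by (auto simp: pderiv_eq_0_iff elim!: degree_eq_zeroE)
qed

text \<open>
  The expansion of an element as a polynomial in the slice with coefficients in the kernel.
\<close>

definition rep :: "'k poly3 \<Rightarrow> 'k poly3 poly" where
  "rep b = (THE P. over_ker P \<and> poly P s = b)"

lemma rep_eqI:
  assumes "over_ker P" "poly P s = b"
  shows "rep b = P"
  unfolding rep_def
proof (rule the_equality)
  show "Q = P" if "over_ker Q \<and> poly Q s = b" for Q
  proof -
    have "over_ker (Q - P)"
      using that assms by (simp add: over_ker_def D_simps)
    then have "Q - P = 0"
      using that assms by (intro slice_transcendental) auto
    then show ?thesis
      by simp
  qed
qed (use assms in simp)

lemma over_ker_rep: "over_ker (rep b)" and poly_rep: "poly (rep b) s = b"
  using slice_expansion_exists[of b] rep_eqI by auto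

lemma rep_ker: "D a = 0 \<Longrightarrow> rep a = [:a:]"
  by (intro rep_eqI) (auto simp: over_ker_pCons over_ker_0)

lemma rep_slice: "rep s = [:0, 1:]"
  by (intro rep_eqI) (auto simp: over_ker_pCons over_ker_0 D_simps)

lemma ring_homo_rep: "ring_homo rep"
proof -
  have "rep (a + b) = rep a + rep b" "rep (a * b) = rep a * rep b" for a b
    by (intro rep_eqI over_ker_add over_ker_mult over_ker_rep; simp add: poly_rep)+
  moreover have "rep 1 = 1"
    using rep_ker[of 1] by (simp only: D_simps pCons_one)
  ultimately show ?thesis
    by (simp add: ring_homo_def)
qed

lemma rep_D: "rep (D b) = pderiv (rep b)"
  by (metis D_poly_slice over_ker_pderiv over_ker_rep poly_rep rep_eqI)

section \<open>Orbits of the additive group action\<close>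

text \<open>
  The polynomial \<open>orbit p b\<close> in the time \<open>t\<close> is the value at \<open>p\<close> of \<open>exp(t D) b\<close>.  In terms of
  the slice expansion, \<open>exp(t D)\<close> is the translation \<open>s \<mapsto> s + t\<close>, so that it is evidently
  a ring homomorphism.
\<close>

definition orbit :: "'k \<times> 'k \<times> 'k \<Rightarrow> 'k poly3 \<Rightarrow> 'k poly" where
  "orbit p b = extend (\<lambda>u. [:ev p u:]) [:ev p s, 1:] (rep b)"

definition flow :: "'k \<Rightarrow> 'k \<times> 'k \<times> 'k \<Rightarrow> 'k \<times> 'k \<times> 'k" where
  "flow t p = (poly (orbit p x3) t, poly (orbit p y3) t, poly (orbit p z3) t)"

lemma ring_homo_const_ev: "ring_homo (\<lambda>u. [:ev p u:])"
  by (rule ring_homo_comp[OF ring_homo_const_poly ring_homo_ev])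

lemma ring_homo_orbit: "ring_homo (orbit p)"
  unfolding orbit_def
  by (rule ring_homo_comp[OF ring_homo_extend[OF ring_homo_const_ev] ring_homo_rep])

lemma orbit_ker: "D a = 0 \<Longrightarrow> orbit p a = [:ev p a:]"
  by (simp add: orbit_def rep_ker extend_const[OF ring_homo_const_ev])

lemma orbit_slice: "orbit p s = [:ev p s, 1:]"
  by (simp add: orbit_def rep_slice extend_var[OF ring_homo_const_ev])

text \<open>Both sides are homomorphisms to \<open>k\<close>, so the variables decide.\<close>

lemma ev_flow: "ev (flow t p) b = poly (orbit p b) t"
proof (rule poly3_homo_eqI[OF ring_homo_ev])
  show "ring_homo (\<lambda>b. poly (orbit p b) t)"
    by (rule ring_homo_comp[OF ring_homo_poly ring_homo_orbit])
qed (auto simp: ev_gens flow_def orbit_ker D_const3)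

lemma poly_orbit: "poly (orbit p b) t = extend (ev p) (ev p s + t) (rep b)"
  unfolding orbit_def extend_comp[OF ring_homo_poly ring_homo_const_ev]
  by simp

lemma orbit_at_0: "poly (orbit p b) 0 = ev p b"
  using ring_homo_apply_poly[OF ring_homo_ev, of p "rep b" s]
  by (simp add: poly_orbit poly_rep)

lemma pderiv_orbit: "pderiv (orbit p b) = orbit p (D b)"
proof -
  note c = ring_homo_const_ev[of p]
  have "pderiv (extend (\<lambda>u. [:ev p u:]) [:e, 1:] P) = extend (\<lambda>u. [:ev p u:]) [:e, 1:] (pderiv P)"
    for e P
    by (induction P)
      (auto simp: extend_0 extend_pCons[OF c] pderiv_pCons pderiv_mult pderiv_add pderiv_smult
        ring_homo_add[OF ring_homo_extend[OF c]] ev_simps algebra_simps)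
  then show ?thesis
    by (simp add: orbit_def rep_D)
qed

lemma ev_flow_ker: "D a = 0 \<Longrightarrow> ev (flow t p) a = ev p a"
  by (simp add: ev_flow orbit_ker)

lemma flow_flow: "flow u (flow t p) = flow (t + u) p"
proof -
  have "poly (orbit (flow t p) b) u = poly (orbit p b) (t + u)" for b
  proof -
    have "ev (flow t p) (coeff (rep b) i) = ev p (coeff (rep b) i)" for i
      using over_ker_rep[of b] by (intro ev_flow_ker) (simp add: over_ker_def)
    then have "extend (ev (flow t p)) r (rep b) = extend (ev p) r (rep b)" for r
      by (rule extend_cong)
    moreover have "ev (flow t p) s = ev p s + t"
      by (simp add: ev_flow orbit_slice)
    ultimately show ?thesis
      by (simp add: poly_orbit add.assoc)
  qed
  then show ?thesis
    by (simp add: flow_def)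
qed

lemma flow_0: "flow 0 p = p"
  by (simp add: flow_def orbit_at_0 ev_gens)

lemma flow_inj: "flow t p = flow t q \<Longrightarrow> p = q"
  by (metis flow_0 flow_flow add.right_inverse)

end

section \<open>Pencils of univariate polynomials\<close>

lemma card_roots_eq_degree:
  fixes P :: "'k::alg_closed_field poly"
  assumes "P \<noteq> 0" "\<And>a. poly P a = 0 \<Longrightarrow> poly (pderiv P) a \<noteq> 0"
  shows "card {a. poly P a = 0} = degree P"
  using assms
proof (induction "degree P" arbitrary: P)
  case 0
  then obtain c where "P = [:c:]"
    by (metis degree_eq_zeroE)
  then show ?case
    using 0 by simp
next
  case (Suc n)
  then obtain r where r: "poly P r = 0"
    using alg_closed_imp_poly_has_root[of P] by auto
  then obtain Q where P: "P = [:-r, 1:] * Q"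
    using poly_eq_0_iff_dvd by blast
  have Q0: "Q \<noteq> 0"
    using Suc.prems P by auto
  have dP: "poly (pderiv P) a = (a - r) * poly (pderiv Q) a + poly Q a" for a
    by (simp add: P pderiv_mult pderiv_pCons pderiv_diff pderiv_smult algebra_simps)
  have "degree P = Suc (degree Q)"
    using Q0 unfolding P by (subst degree_mult_eq) auto
  moreover have "poly (pderiv Q) a \<noteq> 0" if "poly Q a = 0" for a
    using Suc.prems(2)[of a] that dP[of a] by (auto simp: P)
  ultimately have IH: "card {a. poly Q a = 0} = degree Q"
    using Suc Q0 by auto
  have "r \<notin> {a. poly Q a = 0}"
    using Suc.prems(2)[of r] r dP[of r] by auto
  moreover have "{a. poly P a = 0} = insert r {a. poly Q a = 0}"
    by (auto simp: P)
  ultimately show ?case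
    using IH poly_roots_finite[OF Q0] \<open>degree P = Suc (degree Q)\<close> by simp
qed

lemma coeff_shift_top:
  fixes Q :: "'a::comm_ring_1 poly"
  shows "degree Q \<le> n \<Longrightarrow> coeff (pcompose Q [:e, 1:]) n = coeff Q n"
proof (induction n arbitrary: Q)
  case 0
  then obtain c where "Q = [:c:]"
    by (auto elim: degree_eq_zeroE)
  then show ?case
    by simp
next
  case (Suc n)
  obtain a R where Q: "Q = pCons a R"
    by (cases Q)
  have R: "degree R \<le> n"
    using Suc.prems by (auto simp: Q split: if_splits)
  moreover have "coeff (pcompose R [:e, 1:]) (Suc n) = 0"
    using R degree_pcompose_le[of R "[:e, 1:]"] by (intro coeff_eq_0) simp
  ultimately show ?case
    using Suc.IH[of R] by (simp add: Q pcompose_pCons)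
qed

lemma coeff_shift_second:
  fixes Q :: "'a::comm_ring_1 poly"
  shows "degree Q \<le> Suc n \<Longrightarrow>
    coeff (pcompose Q [:e, 1:]) n = coeff Q n + of_nat (Suc n) * e * coeff Q (Suc n)"
proof (induction n arbitrary: Q)
  case 0
  then have "Q = [:coeff Q 0, coeff Q 1:]"
    by (intro poly_eqI) (auto simp: coeff_pCons coeff_eq_0 split: nat.splits)
  then obtain c d where "Q = [:c, d:]"
    by blast
  then show ?case
    by (simp add: pcompose_pCons)
next
  case (Suc n)
  obtain a R where Q: "Q = pCons a R"
    by (cases Q)
  have R: "degree R \<le> Suc n"
    using Suc.prems by (auto simp: Q split: if_splits)
  show ?case
    using Suc.IH[OF R] coeff_shift_top[OF R, of e]
    by (simp add: Q pcompose_pCons algebra_simps)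
qed

text \<open>
  For a pencil \<open>v(c) u - u(c) v\<close> spanned by two polynomials without common zero, a multiple
  root is a zero of the Wronskian; each of these finitely many zeros is a root of the pencil
  member for finitely many \<open>c\<close> only.  So the generic member is squarefree.
\<close>

context
  fixes u v :: "'k::{alg_closed_field, field_char_0} poly" and n :: nat and c0 :: 'k
  assumes degs: "degree u \<le> n" "degree v \<le> n"
    and no_common_root: "\<And>a. \<not> (poly u a = 0 \<and> poly v a = 0)"
    and top: "poly v c0 * coeff u n - poly u c0 * coeff v n \<noteq> 0"
begin

lemma pencil_independent:
  assumes "smult \<alpha> u + smult \<beta> v = 0"
  shows "\<alpha> = 0 \<and> \<beta> = 0"
proof -
  have p: "\<alpha> * poly u c0 + \<beta> * poly v c0 = 0"
    using arg_cong[OF assms, of "\<lambda>P. poly P c0"] by simp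
  have c: "\<alpha> * coeff u n + \<beta> * coeff v n = 0"
    using arg_cong[OF assms, of "\<lambda>P. coeff P n"] by simp
  have "\<alpha> * (poly v c0 * coeff u n - poly u c0 * coeff v n) = 0"
    using p c by algebra
  moreover have "\<beta> * (poly v c0 * coeff u n - poly u c0 * coeff v n) = 0"
    using p c by algebra
  ultimately show ?thesis
    using top by auto
qed

lemma wronskian_nonzero: "pderiv u * v - u * pderiv v \<noteq> 0"
proof
  assume W: "pderiv u * v - u * pderiv v = 0"
  have *: "degree p = 0"
    if eq: "pderiv p * q = p * pderiv q" and ncr: "\<And>a. poly p a = 0 \<Longrightarrow> poly q a \<noteq> 0"
    for p q :: "'k poly"
  proof (rule ccontr)
    assume d: "degree p \<noteq> 0"
    then obtain r where r: "poly p r = 0"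
      using alg_closed_imp_poly_has_root by blast
    have p': "pderiv p \<noteq> 0"
      using d by (simp add: pderiv_eq_0_iff)
    have q: "poly q r \<noteq> 0"
      using ncr r by blast
    then have "pderiv p * q \<noteq> 0"
      using p' by auto
    then have "order r (pderiv p * q) = order r (pderiv p)"
      using q by (simp add: order_mult order_0I)
    moreover have "order r (p * pderiv q) \<ge> order r p"
      using \<open>pderiv p * q \<noteq> 0\<close> unfolding eq by (simp add: order_mult)
    moreover have "order r p = Suc (order r (pderiv p))"
      using p' r d by (intro order_pderiv) (auto simp: order_root)
    ultimately show False
      using eq by simp
  qed
  have "degree u = 0" "degree v = 0"
    using *[of u v] *[of v u] W no_common_root by (auto simp: algebra_simps)
  then obtain u0 v0 where "u = [:u0:]" "v = [:v0:]"
    by (auto elim!: degree_eq_zeroE)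
  then show False
    using top by (cases n) auto
qed

lemma finite_bad_pencil_members:
  "finite {c. \<not> (poly v c * coeff u n - poly u c * coeff v n \<noteq> 0 \<and>
     card {a. poly (smult (poly v c) u - smult (poly u c) v) a = 0} = n)}"
proof -
  define W where "W = pderiv u * v - u * pderiv v"
  define T where "T a = smult (poly u a) v - smult (poly v a) u" for a
  define B where "B = {c. poly (smult (coeff u n) v - smult (coeff v n) u) c = 0} \<union>
    (\<Union>a\<in>{a. poly W a = 0}. {c. poly (T a) c = 0})"
  have "T a \<noteq> 0" for a
    using pencil_independent[of "- poly v a" "poly u a"] no_common_root[of a]
    by (auto simp: T_def)
  moreover have "smult (coeff u n) v - smult (coeff v n) u \<noteq> 0"
    using pencil_independent[of "- coeff v n" "coeff u n"] top by auto
  ultimately have fin: "finite B"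
    using wronskian_nonzero unfolding B_def W_def by (intro finite_UnI finite_UN_I poly_roots_finite)
  have "poly v c * coeff u n - poly u c * coeff v n \<noteq> 0 \<and>
     card {a. poly (smult (poly v c) u - smult (poly u c) v) a = 0} = n" if c: "c \<notin> B" for c
  proof -
    define q where "q = smult (poly v c) u - smult (poly u c) v"
    have lc: "poly v c * coeff u n - poly u c * coeff v n \<noteq> 0"
      using c by (auto simp: B_def algebra_simps)
    then have "coeff q n \<noteq> 0"
      by (simp add: q_def)
    moreover have "degree q \<le> n"
      unfolding q_def using degs by (intro degree_diff_le degree_smult_le[THEN le_trans])
    ultimately have q: "degree q = n" "q \<noteq> 0"
      using le_degree by (auto intro: antisym)
    have "poly (pderiv q) a \<noteq> 0" if a: "poly q a = 0" for a
    proof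
      assume a': "poly (pderiv q) a = 0"
      have 1: "poly v c * poly u a = poly u c * poly v a"
        using a by (simp add: q_def)
      have 2: "poly v c * poly (pderiv u) a = poly u c * poly (pderiv v) a"
        using a' by (simp add: q_def pderiv_diff pderiv_smult)
      have "poly v c * poly W a = 0" "poly u c * poly W a = 0"
        using 1 2 unfolding W_def poly_diff poly_mult by algebra+
      then have "poly W a = 0"
        using no_common_root[of c] by auto
      moreover have "poly (T a) c = 0"
        using 1 by (simp add: T_def algebra_simps)
      ultimately show False
        using c by (auto simp: B_def)
    qed
    then have "card {a. poly q a = 0} = n"
      using card_roots_eq_degree[of q] q by blast
    then show ?thesis
      using lc by (simp add: q_def)
  qed
  then show ?thesis
    by (intro finite_subset[OF _ fin]) blast
qed

text \<open>A binary quadratic form over an algebraically closed field is a product of linear forms.\<close>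

lemma pencil_quadratic_form:
  assumes "smult \<alpha> (v * v) + smult \<beta> (u * v) + smult \<gamma> (u * u) = 0"
  shows "\<alpha> = 0 \<and> \<beta> = 0 \<and> \<gamma> = 0"
proof (cases "\<alpha> = 0")
  case True
  then have "u * (smult \<gamma> u + smult \<beta> v) = 0"
    using assms by (simp add: algebra_simps)
  moreover have "u \<noteq> 0"
    using pencil_independent[of 1 0] by auto
  ultimately show ?thesis
    using pencil_independent[of \<gamma> \<beta>] True by auto
next
  case False
  then obtain r where r: "\<alpha> * r\<^sup>2 + \<beta> * r + \<gamma> = 0"
    using alg_closed_imp_poly_has_root[of "[:\<gamma>, \<beta>, \<alpha>:]"]
    by (auto simp: algebra_simps power2_eq_square)
  have \<gamma>: "\<gamma> = - r * (\<beta> + \<alpha> * r)"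
    using r by algebra
  have "(v - smult r u) * (smult \<alpha> v + smult (\<beta> + \<alpha> * r) u) =
      smult \<alpha> (v * v) + smult \<beta> (u * v) + smult \<gamma> (u * u)"
    unfolding \<gamma> by (simp add: algebra_simps smult_diff_right smult_diff_left
      smult_add_right smult_add_left)
  then have "v - smult r u = 0 \<or> smult \<alpha> v + smult (\<beta> + \<alpha> * r) u = 0"
    using assms by simp
  then show ?thesis
    using pencil_independent[of "- r" 1] pencil_independent[of "\<beta> + \<alpha> * r" \<alpha>] False
    by (auto simp: algebra_simps)
qed

end

section \<open>Orbits project to straight lines\<close>

locale nice_derivation = slice_derivation +
  assumes D2x: "D (D x3) = 0" and D2y: "D (D y3) = 0"
begin

abbreviation f :: "'a poly3" where "f \<equiv> D x3"
abbreviation g :: "'a poly3" where "g \<equiv> D y3"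
abbreviation h :: "'a poly3" where "h \<equiv> D z3"

lemma orbit_affine:
  assumes "D (D b) = 0"
  shows "poly (orbit p b) t = ev p b + t * ev p (D b)"
proof -
  have "pderiv (orbit p b - [:0, ev p (D b):]) = 0"
    using orbit_ker[OF assms] by (simp add: pderiv_diff pderiv_orbit pderiv_pCons)
  then obtain c where c: "orbit p b - [:0, ev p (D b):] = [:c:]"
    by (auto simp: pderiv_eq_0_iff elim: degree_eq_zeroE)
  then have "orbit p b = [:0, ev p (D b):] + [:c:]"
    by (metis diff_add_cancel add.commute)
  then show ?thesis
    using orbit_at_0[of p b] by simp
qed

lemma flow_eq:
  "flow t (a, b, c) = (a + t * ev (a, b, c) f, b + t * ev (a, b, c) g, poly (orbit (a, b, c) z3) t)"
  by (simp add: flow_def orbit_affine D2x D2y ev_gens)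

lemma flow_eq':
  "flow t p = (fst p + t * ev p f, fst (snd p) + t * ev p g, poly (orbit p z3) t)"
  by (cases p) (simp add: flow_eq)

text \<open>
  Where \<open>f\<close> and \<open>g\<close> vanish, the orbit moves along a vertical line, and it fills this line: the
  slice grows along it, so its third coordinate is a nonconstant polynomial.
\<close>

lemma vertical_orbit:
  assumes "ev (a, b, c0) f = 0" "ev (a, b, c0) g = 0" "D u = 0"
  shows "ev (a, b, c) u = ev (a, b, c0) u"
proof -
  let ?p = "(a, b, c0)"
  have fl: "flow t ?p = (a, b, poly (orbit ?p z3) t)" for t
    using assms by (simp add: flow_eq)
  have "degree (orbit ?p z3) > 0"
  proof (rule ccontr)
    assume "\<not> degree (orbit ?p z3) > 0"
    then obtain k where "orbit ?p z3 = [:k:]"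
      by (auto elim: degree_eq_zeroE)
    then have "flow 1 ?p = flow 0 ?p"
      by (simp add: fl)
    then have "poly (orbit ?p s) 1 = poly (orbit ?p s) 0"
      by (metis ev_flow)
    then show False
      by (simp add: orbit_slice)
  qed
  then obtain t where "poly (orbit ?p z3) t = c"
    by (rule poly_surj_alg_closed)
  then show ?thesis
    using ev_flow_ker[OF assms(3), of t ?p] by (simp add: fl)
qed


text \<open>
  Suppose the direction of an orbit line depends only on the point of the plane through which
  it passes.  Two nonparallel lines then meet in a zero of \<open>(F, G)\<close>; a fixed generic line
  contains finitely many of these.  As \<open>B\<close> is a domain, either all lines are parallel or all
  pass through the same zero \<open>(a0, b0)\<close> on the fixed line.  But in the second case \<open>f\<close> vanishes over \<open>x = a0\<close>, which every line with \<open>f \<noteq> 0\<close> crosses.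
\<close>

lemma dependent_if_direction_in_xy:
  fixes F G :: "'a poly poly"
  assumes fG: "f * [:G:] = g * [:F:]" and FG: "F \<noteq> 0 \<or> G \<noteq> 0"
  shows "\<exists>\<alpha> \<beta>. (\<alpha> \<noteq> 0 \<or> \<beta> \<noteq> 0) \<and> const3 \<alpha> * f + const3 \<beta> * g = 0"
proof (rule ccontr)
  assume "\<not> ?thesis"
  then have indep: "const3 \<alpha> * f + const3 \<beta> * g = 0 \<Longrightarrow> \<alpha> = 0 \<and> \<beta> = 0" for \<alpha> \<beta>
    by blast
  have f0: "f \<noteq> 0" and g0: "g \<noteq> 0"
    using indep[of 1 0] indep[of 0 1]
    by (auto simp: ring_homo_0[OF ring_homo_const3] ring_homo_1[OF ring_homo_const3])
  have F0: "F \<noteq> 0"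
    using FG fG f0 by auto
  then have "f * [:F:] \<noteq> 0"
    using f0 by simp
  then obtain p where "ev p (f * [:F:]) \<noteq> 0"
    by (rule ev_nonzero_point)
  then have p: "ev p f \<noteq> 0" "ev p [:F:] \<noteq> 0"
    unfolding ring_homo_mult[OF ring_homo_ev] by auto
  obtain a b c where p_eq: "p = (a, b, c)"
    by (cases p)
  define \<phi> \<gamma> where "\<phi> = ev p f" and "\<gamma> = ev p g"
  define T where "T = {t. poly (orbit p [:F:]) t = 0}"
  have "poly (orbit p [:F:]) 0 \<noteq> 0"
    using p by (simp add: orbit_at_0)
  then have finT: "finite T"
    unfolding T_def by (intro poly_roots_finite) auto
  define M where "M t = f * (const3 (b + t * \<gamma>) - y3) - g * (const3 (a + t * \<phi>) - x3)" for t
  define Q where "Q = (const3 \<phi> * g - const3 \<gamma> * f) * (\<Prod>t\<in>T. M t)"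
  have dir: "ev q f * ev2 (fst q) (fst (snd q)) G = ev q g * ev2 (fst q) (fst (snd q)) F" for q
    using arg_cong[OF fG, of "ev q"] unfolding ring_homo_mult[OF ring_homo_ev]
    by (cases q) (simp add: ev_const)
  have fl: "flow t p = (a + t * \<phi>, b + t * \<gamma>, poly (orbit p z3) t)" for t
    by (simp add: flow_eq' \<phi>_def \<gamma>_def) (simp add: p_eq)
  have ev_fl: "ev (flow t p) f = \<phi>" "ev (flow t p) g = \<gamma>" for t
    using ev_flow_ker[OF D2x] ev_flow_ker[OF D2y] by (simp_all add: \<phi>_def \<gamma>_def)
  have "ev q Q = 0" for q
  proof (cases "\<phi> * ev q g - \<gamma> * ev q f = 0")
    case True
    then show ?thesis
      by (simp add: Q_def ev_simps ev_gens)
  next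
    case False
    obtain a' b' c' where q: "q = (a', b', c')"
      by (cases q)
    define \<delta> where "\<delta> = \<phi> * ev q g - \<gamma> * ev q f"
    have \<delta>: "\<delta> \<noteq> 0"
      using False by (simp add: \<delta>_def)
    \<comment> \<open>Cramer's rule for the times at which the two lines reach their common point.\<close>
    define t where "t = ((a' - a) * ev q g - (b' - b) * ev q f) / \<delta>"
    define w where "w = ((a' - a) * \<gamma> - (b' - b) * \<phi>) / \<delta>"
    have t: "t * \<delta> = (a' - a) * ev q g - (b' - b) * ev q f"
      and w: "w * \<delta> = (a' - a) * \<gamma> - (b' - b) * \<phi>"
      using \<delta> by (simp_all add: t_def w_def)
    have "(a + t * \<phi>) * \<delta> = (a' + w * ev q f) * \<delta>"
      using t w unfolding \<delta>_def by algebra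
    then have x: "a + t * \<phi> = a' + w * ev q f"
      using \<delta> by simp
    have "(b + t * \<gamma>) * \<delta> = (b' + w * ev q g) * \<delta>"
      using t w unfolding \<delta>_def by algebra
    then have y: "b + t * \<gamma> = b' + w * ev q g"
      using \<delta> by simp
    have "\<phi> * ev2 (a + t * \<phi>) (b + t * \<gamma>) G = \<gamma> * ev2 (a + t * \<phi>) (b + t * \<gamma>) F"
      using dir[of "flow t p"] unfolding ev_fl by (simp add: fl)
    moreover have "ev q f * ev2 (a + t * \<phi>) (b + t * \<gamma>) G = ev q g * ev2 (a + t * \<phi>) (b + t * \<gamma>) F"
      using dir[of "flow w q"] unfolding ev_flow_ker[OF D2x] ev_flow_ker[OF D2y]
      by (simp add: flow_eq' x y) (simp add: q)
    ultimately have "\<delta> * ev2 (a + t * \<phi>) (b + t * \<gamma>) F = 0"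
      unfolding \<delta>_def by algebra
    then have "ev (flow t p) [:F:] = 0"
      using \<delta> by (simp add: fl ev_const)
    then have "t \<in> T"
      by (simp add: T_def ev_flow)
    moreover have "ev q (M t) = 0"
      by (simp add: M_def ev_simps ev_gens q[symmetric] x y) (simp add: q algebra_simps)
    ultimately have "(\<Prod>t\<in>T. ev q (M t)) = 0"
      using finT by auto
    then show ?thesis
      by (simp add: Q_def ev_simps ring_homo_prod[OF ring_homo_ev])
  qed
  then have "Q = 0"
    by (rule ev_all_0)
  moreover have "const3 \<phi> * g - const3 \<gamma> * f \<noteq> 0"
    using indep[of "- \<gamma>" \<phi>] p
    by (auto simp: ring_homo_minus[OF ring_homo_const3] algebra_simps ev_simps \<phi>_def)
  ultimately obtain t where "M t = 0"
    using finT by (auto simp: Q_def)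
  then obtain a0 b0 where M: "f * (const3 b0 - y3) = g * (const3 a0 - x3)"
    unfolding M_def by auto
  \<comment> \<open>The factor \<open>b0 - y\<close> can be cancelled on the plane \<open>x = a0\<close>, since a polynomial that vanishes
    off one point vanishes at that point too.\<close>
  have off: "ev (a0, d, e) f * (b0 - d) = 0" for d e
    using arg_cong[OF M, of "ev (a0, d, e)"] by (simp add: ev_simps ev_gens)
  have f_a0: "ev (a0, d, e) f = 0" for d e
  proof -
    define P where "P = eval3 (\<lambda>k. [:k:]) [:a0:] [:0, 1:] [:e:] f"
    have P: "poly P d = ev (a0, d, e) f" for d
      unfolding P_def
      by (rule poly3_homo_eqI[OF ring_homo_comp[OF ring_homo_poly ring_homo_eval3] ring_homo_ev])
        (simp_all add: eval3_gens ev_gens ring_homo_const_poly)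
    have "poly (P * [:b0, -1:]) d = 0" for d
      using off[of d e] by (simp add: P)
    then have "P * [:b0, -1:] = 0"
      using poly_all_0_iff_0 by blast
    then have "P = 0"
      by (simp only: mult_eq_0_iff) simp
    then show ?thesis
      using P[of d] by simp
  qed
  have \<phi>0: "\<phi> \<noteq> 0"
    using p by (auto simp: ev_simps \<phi>_def)
  have "ev (flow ((a0 - a) / \<phi>) p) f = 0"
    using \<phi>0 f_a0 by (simp add: fl)
  then show False
    using \<phi>0 ev_flow_ker[OF D2x] by (simp add: \<phi>_def)
qed

end

section \<open>Orbit lines of variable direction\<close>

lemma degree_0_of_no_root:
  fixes P :: "'k::alg_closed_field poly"
  assumes "\<And>t. poly P t \<noteq> 0"
  shows "degree P = 0"
  using alg_closed_imp_poly_has_root[of P] assms by auto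

lemma poly_eq_of_values:
  fixes P Q :: "'k::{idom, ring_char_0} poly"
  shows "(\<And>t. poly P t = poly Q t) \<Longrightarrow> P = Q"
  using poly_eq_poly_eq_iff by blast

locale independent_directions = nice_derivation +
  assumes indep: "\<And>\<alpha> \<beta>. const3 \<alpha> * f + const3 \<beta> * g = 0 \<Longrightarrow> \<alpha> = 0 \<and> \<beta> = 0"
begin

definition n :: nat where "n = max (degree f) (degree g)"
definition F where "F = coeff f n"
definition G where "G = coeff g n"
definition u where "u = coeff f (n - 1)"
definition v where "v = coeff g (n - 1)"
text \<open>The leading coefficient of the pencil of a point over its own projection.\<close>

definition L where "L = g * [:F:] - f * [:G:]"

lemma degree_fg: "degree f \<le> n" "degree g \<le> n"
  by (simp_all add: n_def)

lemma L_nonzero: "L \<noteq> 0"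
proof
  assume L: "L = 0"
  have "f \<noteq> 0 \<and> g \<noteq> 0"
    using indep[of 1 0] indep[of 0 1]
    by (auto simp: ring_homo_0[OF ring_homo_const3] ring_homo_1[OF ring_homo_const3])
  then have "F \<noteq> 0 \<or> G \<noteq> 0"
    by (auto simp: F_def G_def n_def max_def)
  moreover have "f * [:G:] = g * [:F:]"
    using L by (simp add: L_def)
  ultimately show False
    using dependent_if_direction_in_xy indep by blast
qed

text \<open>For \<open>n = 0\<close> the velocity would be a function of \<open>x\<close> and \<open>y\<close>.\<close>

lemma n_pos: "n > 0"
proof (rule ccontr)
  assume "\<not> n > 0"
  then have "degree f = 0" "degree g = 0" "n = 0"
    using degree_fg by auto
  then have "f = [:F:]" "g = [:G:]"
    unfolding F_def G_def by (auto elim!: degree_eq_zeroE)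
  then have "L = [:G:] * [:F:] - [:F:] * [:G:]"
    unfolding L_def by metis
  then show False
    using L_nonzero by simp
qed

text \<open>
  The roots of \<open>pencil p a b\<close> are the third coordinates of the points over \<open>(a, b)\<close> whose
  velocity in the plane is proportional to that of \<open>p\<close>, or zero.
\<close>

definition pencil :: "'a \<times> 'a \<times> 'a \<Rightarrow> 'a \<Rightarrow> 'a \<Rightarrow> 'a poly" where
  "pencil p a b = smult (ev p g) (fibre a b f) - smult (ev p f) (fibre a b g)"

lemma degree_fibre: "degree w \<le> m \<Longrightarrow> degree (fibre a b w) \<le> m"
  unfolding fibre_def by (rule le_trans[OF map_poly_degree_leq])

lemma degree_pencil: "degree (pencil p a b) \<le> n"
  unfolding pencil_def
  by (intro degree_diff_le degree_smult_le[THEN le_trans] degree_fibre degree_fg)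

lemma poly_pencil: "poly (pencil p a b) c = ev p g * ev (a, b, c) f - ev p f * ev (a, b, c) g"
  by (simp add: pencil_def ev_fibre)

lemma coeff_pencil:
  "coeff (pencil p a b) i = ev p g * ev2 a b (coeff f i) - ev p f * ev2 a b (coeff g i)"
  by (simp add: pencil_def coeff_fibre)

text \<open>
  Two points over the same point of the plane with proportional velocities: after a change of
  time their orbits lie over the same line, at the same speed.
\<close>

lemma transport:
  assumes nz: "ev (a, b, c) f \<noteq> 0 \<or> ev (a, b, c) g \<noteq> 0"
    and root: "poly (pencil (a, b, c) a b) e = 0"
  shows "\<exists>\<mu> P. \<mu> \<noteq> 0 \<and> ev (a, b, e) f = \<mu> * ev (a, b, c) f \<and> ev (a, b, e) g = \<mu> * ev (a, b, c) g \<and>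
    (\<forall>t. flow (t / \<mu>) (a, b, e) =
      (a + t * ev (a, b, c) f, b + t * ev (a, b, c) g, poly P t))"
proof -
  let ?p = "(a, b, c)" and ?q = "(a, b, e)"
  have proportional: "ev ?p g * ev ?q f = ev ?p f * ev ?q g"
    using root by (simp add: poly_pencil)
  obtain \<mu> where \<mu>: "ev ?q f = \<mu> * ev ?p f" "ev ?q g = \<mu> * ev ?p g"
  proof (cases "ev ?p f = 0")
    case True
    then show ?thesis
      using nz proportional that[of "ev ?q g / ev ?p g"] by simp
  next
    case False
    then show ?thesis
      using proportional that[of "ev ?q f / ev ?p f"] by (simp add: field_simps)
  qed
  have "\<mu> \<noteq> 0"
  proof
    assume "\<mu> = 0"
    then have "ev ?q f = 0" "ev ?q g = 0"
      using \<mu> by auto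
    then show False
      using vertical_orbit[of a b e _ c] D2x D2y nz by metis
  qed
  moreover have "flow (t / \<mu>) ?q = (a + t * ev ?p f, b + t * ev ?p g,
      poly (pcompose (orbit ?q z3) [:0, 1 / \<mu>:]) t)" for t
    using \<open>\<mu> \<noteq> 0\<close> by (simp add: flow_eq \<mu> poly_pcompose)
  ultimately show ?thesis
    using \<mu> by blast
qed

text \<open>
  Along the orbit line of a point \<open>p\<close> whose pencil has \<open>n\<close> distinct roots, the roots are carried
  along by the flow and never meet.  Over an algebraically closed field a polynomial without
  zeros is constant; so the leading coefficient and the root differences of the pencil are
  constant on the line.  Hence the pencil over time \<open>t\<close> is the one over time \<open>0\<close>,
  translated by the third coordinate of the orbit.
\<close>

lemma pencil_along_orbit:
  assumes p: "p = (a, b, c)"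
    and nz: "ev p g * ev2 a b F - ev p f * ev2 a b G \<noteq> 0"
    and card: "card {e. poly (pencil p a b) e = 0} = n"
  shows "ev p (g * D [:F:] - f * D [:G:]) = 0"
    and "ev p (g * D [:u:] - f * D [:v:] + of_nat n * L * h) = 0"
proof -
  define \<phi> \<gamma> where "\<phi> = ev p f" and "\<gamma> = ev p g"
  define R where "R = {e. poly (pencil p a b) e = 0}"
  have nz': "ev (a, b, c) f \<noteq> 0 \<or> ev (a, b, c) g \<noteq> 0"
    using nz p by auto
  have finR: "finite R" and cardR: "card R = n"
    using card n_pos by (auto simp: R_def intro: card_ge_0_finite)
  have cR: "c \<in> R"
    by (simp add: R_def poly_pencil p)
  obtain \<mu> P where \<mu>P: "\<And>e. e \<in> R \<Longrightarrow> \<mu> e \<noteq> 0 \<and> ev (a, b, e) f = \<mu> e * \<phi> \<and> ev (a, b, e) g = \<mu> e * \<gamma> \<and>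
      (\<forall>t. flow (t / \<mu> e) (a, b, e) = (a + t * \<phi>, b + t * \<gamma>, poly (P e) t))"
    using transport[OF nz'] unfolding R_def p \<phi>_def \<gamma>_def mem_Collect_eq by metis
  define pen where "pen t = pencil p (a + t * \<phi>) (b + t * \<gamma>)" for t
  have pen0: "pen 0 = pencil p a b"
    by (simp add: pen_def)
  have root: "poly (pen t) (poly (P e) t) = 0" if "e \<in> R" for e t
  proof -
    have fl: "flow (t / \<mu> e) (a, b, e) = (a + t * \<phi>, b + t * \<gamma>, poly (P e) t)"
      using \<mu>P[OF that] by blast
    show ?thesis
      using \<mu>P[OF that] ev_flow_ker[OF D2x, of "t / \<mu> e" "(a, b, e)"]
        ev_flow_ker[OF D2y, of "t / \<mu> e" "(a, b, e)"]
      unfolding fl by (simp add: pen_def poly_pencil \<phi>_def[symmetric] \<gamma>_def[symmetric])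
  qed
  have \<phi>\<gamma>: "\<phi> \<noteq> 0 \<or> \<gamma> \<noteq> 0"
    using nz' by (simp add: \<phi>_def \<gamma>_def p)
  have distinct: "e = e'" if "e \<in> R" "e' \<in> R" "poly (P e) t = poly (P e') t" for e e' t
  proof -
    have fl: "flow (t / \<mu> e) (a, b, e) = flow (t / \<mu> e') (a, b, e')"
      using \<mu>P[OF that(1)] \<mu>P[OF that(2)] that(3) by simp
    have "ev (a, b, e) f = ev (a, b, e') f" "ev (a, b, e) g = ev (a, b, e') g"
      using ev_flow_ker[OF D2x] ev_flow_ker[OF D2y] fl by metis+
    then have "\<mu> e = \<mu> e'"
      using \<mu>P[OF that(1)] \<mu>P[OF that(2)] \<phi>\<gamma> by auto
    then show ?thesis
      using fl flow_inj by (metis prod.inject)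
  qed
  have P0: "poly (P e) 0 = e" if "e \<in> R" for e
  proof -
    have "flow (0 / \<mu> e) (a, b, e) = (a + 0 * \<phi>, b + 0 * \<gamma>, poly (P e) 0)"
      using \<mu>P[OF that] by blast
    then show ?thesis
      by (simp add: flow_0)
  qed
  have Pc: "poly (P c) t = poly (orbit p z3) t" for t
  proof -
    have "\<mu> c = 1"
      using \<mu>P[OF cR] \<phi>\<gamma> by (auto simp: \<phi>_def \<gamma>_def p)
    then have "flow t (a, b, c) = (a + t * \<phi>, b + t * \<gamma>, poly (P c) t)"
      using \<mu>P[OF cR] by (metis div_by_1)
    then show ?thesis
      by (simp add: flow_eq p)
  qed

  \<comment> \<open>If the leading coefficient vanished at time \<open>t\<close>, the \<open>n\<close> roots would make the pencil
    vanish identically there, and flowing back would give infinitely many roots at time 0.\<close>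
  have lead: "coeff (pen t) n \<noteq> 0" for t
  proof
    assume 0: "coeff (pen t) n = 0"
    have "inj_on (\<lambda>e. poly (P e) t) R"
      using distinct by (auto intro: inj_onI)
    then have "card ((\<lambda>e. poly (P e) t) ` R) = n"
      using cardR by (simp add: card_image)
    moreover have "degree (pen t) < n"
      using 0 degree_pencil[of p] n_pos unfolding pen_def
      by (metis degree_0 eq_zero_or_degree_less)
    ultimately have pen_t: "pen t = 0"
      using root n_pos by (intro poly_eqI_degree[of "(\<lambda>e. poly (P e) t) ` R"]) auto
    define q where "q = flow t p"
    obtain d where q: "q = (a + t * \<phi>, b + t * \<gamma>, d)"
      by (simp add: q_def flow_eq p \<phi>_def \<gamma>_def)
    have evq: "ev q f = \<phi>" "ev q g = \<gamma>"
      using ev_flow_ker[OF D2x, of t p] ev_flow_ker[OF D2y, of t p]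
      by (simp_all add: q_def \<phi>_def \<gamma>_def)
    have "pencil q (a + t * \<phi>) (b + t * \<gamma>) = pen t"
      by (simp add: pencil_def pen_def evq \<phi>_def \<gamma>_def)
    then have "\<exists>\<mu> P. \<mu> \<noteq> 0 \<and> ev (a + t * \<phi>, b + t * \<gamma>, e) f = \<mu> * \<phi> \<and>
        ev (a + t * \<phi>, b + t * \<gamma>, e) g = \<mu> * \<gamma> \<and>
        (\<forall>r. flow (r / \<mu>) (a + t * \<phi>, b + t * \<gamma>, e) =
          (a + t * \<phi> + r * \<phi>, b + t * \<gamma> + r * \<gamma>, poly P r))" for e
      using transport[of "a + t * \<phi>" "b + t * \<gamma>" d e] \<phi>\<gamma> pen_t
      by (simp add: q[symmetric] evq)
    then obtain \<nu> S where \<nu>S: "\<nu> e \<noteq> 0" "ev (a + t * \<phi>, b + t * \<gamma>, e) f = \<nu> e * \<phi>"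
        "ev (a + t * \<phi>, b + t * \<gamma>, e) g = \<nu> e * \<gamma>"
        "\<And>r. flow (r / \<nu> e) (a + t * \<phi>, b + t * \<gamma>, e) =
          (a + t * \<phi> + r * \<phi>, b + t * \<gamma> + r * \<gamma>, poly (S e) r)" for e
      by metis
    have flow_back: "flow (- t / \<nu> e) (a + t * \<phi>, b + t * \<gamma>, e) = (a, b, poly (S e) (- t))" for e
      using \<nu>S(4)[of "- t" e] by simp
    have ev_flow_back: "ev (a, b, poly (S e) (- t)) f = \<nu> e * \<phi>"
        "ev (a, b, poly (S e) (- t)) g = \<nu> e * \<gamma>" for e
      using ev_flow_ker[OF D2x, of "- t / \<nu> e"] ev_flow_ker[OF D2y, of "- t / \<nu> e"] flow_back[of e]
        \<nu>S(2,3)[of e] by metis+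
    have "poly (S e) (- t) \<in> R" for e
      by (simp add: R_def poly_pencil ev_flow_back) (simp add: \<phi>_def \<gamma>_def)
    moreover have "inj (\<lambda>e. poly (S e) (- t))"
    proof (rule injI)
      fix e e' assume eq: "poly (S e) (- t) = poly (S e') (- t)"
      then have "\<nu> e = \<nu> e'"
        using ev_flow_back[of e] ev_flow_back[of e'] \<phi>\<gamma> by auto
      then have "flow (- t / \<nu> e) (a + t * \<phi>, b + t * \<gamma>, e) =
          flow (- t / \<nu> e) (a + t * \<phi>, b + t * \<gamma>, e')"
        using flow_back[of e] flow_back[of e'] eq by simp
      then show "e = e'"
        using flow_inj by (metis prod.inject)
    qed
    ultimately have "finite (UNIV :: 'a set)"
      using finR by (metis finite_imageD finite_subset image_subsetI)
    then show False
      by (simp add: infinite_UNIV_char_0)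
  qed

  define \<Lambda> where "\<Lambda> = smult \<gamma> (orbit p [:F:]) - smult \<phi> (orbit p [:G:])"
  have fl: "flow t p = (a + t * \<phi>, b + t * \<gamma>, poly (orbit p z3) t)" for t
    by (simp add: flow_eq p \<phi>_def \<gamma>_def)
  have orb: "poly (orbit p [:w:]) t = ev2 (a + t * \<phi>) (b + t * \<gamma>) w" for w t
    using ev_flow[of t p "[:w:]"] by (simp add: fl ev_const)
  have \<Lambda>: "poly \<Lambda> t = coeff (pen t) n" for t
    by (simp add: \<Lambda>_def orb pen_def coeff_pencil F_def G_def \<phi>_def \<gamma>_def)
  then have "degree \<Lambda> = 0"
    using lead by (intro degree_0_of_no_root) simp
  then obtain \<kappa> where \<kappa>: "\<Lambda> = [:\<kappa>:]"
    by (rule degree_eq_zeroE)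
  have "poly \<Lambda> 0 = ev p L"
    unfolding L_def ring_homo_diff[OF ring_homo_ev] ring_homo_mult[OF ring_homo_ev]
    by (simp add: \<Lambda>_def orbit_at_0 \<phi>_def \<gamma>_def)
  then have \<kappa>_eq: "\<kappa> = ev p L"
    by (simp add: \<kappa>)
  have "poly (pderiv \<Lambda>) 0 = 0"
    by (simp add: \<kappa> pderiv_pCons)
  then show "ev p (g * D [:F:] - f * D [:G:]) = 0"
    by (simp add: \<Lambda>_def pderiv_diff pderiv_smult pderiv_orbit orbit_at_0 ev_simps \<phi>_def \<gamma>_def)

  have P_eq: "poly (P e) t = poly (orbit p z3) t + (e - c)" if e: "e \<in> R" for e t
  proof (cases "e = c")
    case False
    have "poly (P e - P c) t \<noteq> 0" for t
      using distinct[OF e cR] False by auto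
    then have "degree (P e - P c) = 0"
      by (rule degree_0_of_no_root)
    then obtain k where k: "P e - P c = [:k:]"
      by (rule degree_eq_zeroE)
    have "poly (P e - P c) 0 = e - c"
      using P0[OF e] P0[OF cR] by simp
    then show ?thesis
      using k Pc[of t] arg_cong[OF k, of "\<lambda>P. poly P t"] by (simp add: algebra_simps)
  qed (simp add: Pc)
  \<comment> \<open>Two polynomials of degree at most \<open>n\<close> with equal leading coefficients and \<open>n\<close> common roots.\<close>
  have pen_shift: "pen t = pcompose (pen 0) [:- (poly (orbit p z3) t - c), 1:]" for t
  proof (rule poly_eqI_degree_lead_coeff)
    show "degree (pen t) \<le> n"
      unfolding pen_def by (rule degree_pencil)
    show "degree (pcompose (pen 0) [:- (poly (orbit p z3) t - c), 1:]) \<le> n"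
      using degree_pcompose_le[of "pen 0" "[:- (poly (orbit p z3) t - c), 1:]"] degree_pencil[of p a b]
      by (simp add: pen0)
    show "coeff (pen t) n = coeff (pcompose (pen 0) [:- (poly (orbit p z3) t - c), 1:]) n"
      using coeff_shift_top[of "pen 0" n] degree_pencil[of p a b] \<Lambda>[of t] \<Lambda>[of 0]
      by (simp add: pen0 \<kappa>)
    have "inj_on (\<lambda>e. poly (P e) t) R"
      using distinct by (auto intro: inj_onI)
    then show "n \<le> card ((\<lambda>e. poly (P e) t) ` R)"
      using cardR by (simp add: card_image)
    fix z assume "z \<in> (\<lambda>e. poly (P e) t) ` R"
    then obtain e where e: "e \<in> R" "z = poly (P e) t"
      by blast
    then have "z - (poly (orbit p z3) t - c) = e"
      using P_eq[of e t] by simp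
    then have "poly (pcompose (pen 0) [:- (poly (orbit p z3) t - c), 1:]) z = poly (pen 0) e"
      by (simp add: poly_pcompose algebra_simps)
    also have "\<dots> = 0"
      using e(1) by (simp add: R_def pen0)
    finally show "poly (pen t) z = poly (pcompose (pen 0) [:- (poly (orbit p z3) t - c), 1:]) z"
      using root[OF e(1)] e(2) by simp
  qed
  \<comment> \<open>Under the translation the second coefficient moves by \<open>n\<close> times the leading one.\<close>
  define \<Gamma> where "\<Gamma> = smult \<gamma> (orbit p [:u:]) - smult \<phi> (orbit p [:v:]) +
      smult (of_nat n * \<kappa>) (orbit p z3)"
  have "poly \<Gamma> t = coeff (pen 0) (n - 1) + of_nat n * \<kappa> * c" for t
  proof -
    have "coeff (pen t) (n - 1) =
        coeff (pen 0) (n - 1) - of_nat n * (poly (orbit p z3) t - c) * coeff (pen 0) n"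
      using coeff_shift_second[of "pen 0" "n - 1" "- (poly (orbit p z3) t - c)"]
        degree_pencil[of p a b] n_pos
      by (subst pen_shift) (simp add: pen0 algebra_simps)
    moreover have "coeff (pen 0) n = \<kappa>"
      using \<Lambda>[of 0] by (simp add: \<kappa>)
    moreover have "coeff (pen t) (n - 1) = poly (smult \<gamma> (orbit p [:u:]) - smult \<phi> (orbit p [:v:])) t"
      by (simp add: orb pen_def coeff_pencil u_def v_def \<phi>_def \<gamma>_def)
    ultimately show ?thesis
      unfolding \<Gamma>_def poly_add poly_smult by algebra
  qed
  then have "\<Gamma> = [:coeff (pen 0) (n - 1) + of_nat n * \<kappa> * c:]"
    by (intro poly_eq_of_values) simp
  then have "poly (pderiv \<Gamma>) 0 = 0"
    by (simp add: pderiv_pCons)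
  then show "ev p (g * D [:u:] - f * D [:v:] + of_nat n * L * h) = 0"
    by (simp add: \<Gamma>_def pderiv_diff pderiv_add pderiv_smult pderiv_orbit orbit_at_0 ev_simps
        \<phi>_def \<gamma>_def \<kappa>_eq)
qed

text \<open>
  The points to which the preceding lemma applies are dense: on a vertical line that meets
  \<open>L \<noteq> 0\<close>, the polynomials \<open>f\<close> and \<open>g\<close> have no common zero, as they would vanish on the whole
  line otherwise, so only finitely many points of it are excluded.
\<close>

lemma zero_if_zero_at_generic:
  assumes "\<And>p a b c. p = (a, b, c) \<Longrightarrow> ev p g * ev2 a b F - ev p f * ev2 a b G \<noteq> 0 \<Longrightarrow>
    card {e. poly (pencil p a b) e = 0} = n \<Longrightarrow> ev p w = 0"
  shows "w = 0"
proof (rule ev_dense_0[OF L_nonzero])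
  fix p assume L: "ev p L \<noteq> 0"
  obtain a b c0 where p: "p = (a, b, c0)"
    by (cases p)
  let ?f = "fibre a b f" and ?g = "fibre a b g"
  have L': "ev p g * ev2 a b F - ev p f * ev2 a b G \<noteq> 0"
    using L unfolding L_def ring_homo_diff[OF ring_homo_ev] ring_homo_mult[OF ring_homo_ev]
    by (simp add: p ev_const)
  have ncr: "\<not> (poly ?f e = 0 \<and> poly ?g e = 0)" for e
    using vertical_orbit[of a b e _ c0] D2x D2y L' unfolding ev_fibre[symmetric] p
    by (metis diff_self mult_zero_left)
  have "finite {c. \<not> (poly ?g c * coeff ?f n - poly ?f c * coeff ?g n \<noteq> 0 \<and>
      card {e. poly (smult (poly ?g c) ?f - smult (poly ?f c) ?g) e = 0} = n)}"
    by (rule finite_bad_pencil_members[where ?c0.0 = c0])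
      (use degree_fibre degree_fg ncr L' in \<open>auto simp: coeff_fibre p ev_fibre F_def G_def\<close>)
  moreover have "poly (fibre a b w) c = 0"
    if "poly ?g c * coeff ?f n - poly ?f c * coeff ?g n \<noteq> 0 \<and>
      card {e. poly (smult (poly ?g c) ?f - smult (poly ?f c) ?g) e = 0} = n" for c
    using assms[of "(a, b, c)" a b c] that
    by (simp add: pencil_def ev_fibre coeff_fibre F_def G_def)
  ultimately have "finite {c. poly (fibre a b w) c \<noteq> 0}"
    by (elim finite_subset[rotated]) blast
  then have "fibre a b w = 0"
  proof -
    assume fin: "finite {c. poly (fibre a b w) c \<noteq> 0}"
    show ?thesis
    proof (rule ccontr)
      assume "fibre a b w \<noteq> 0"
      then have "finite {c. poly (fibre a b w) c = 0}"
        by (rule poly_roots_finite)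
      then have "finite ({c. poly (fibre a b w) c \<noteq> 0} \<union> {c. poly (fibre a b w) c = 0})"
        using fin by blast
      moreover have "{c. poly (fibre a b w) c \<noteq> 0} \<union> {c. poly (fibre a b w) c = 0} = UNIV"
        by blast
      ultimately show False
        by (simp add: infinite_UNIV_char_0)
    qed
  qed
  then show "ev p w = 0"
    by (simp add: p ev_fibre)
qed

lemma lead_coeffs_constant_along_orbits: "g * D [:F:] - f * D [:G:] = 0"
  by (rule zero_if_zero_at_generic) (rule pencil_along_orbit(1))

lemma translation_identity: "g * D [:u:] - f * D [:v:] + of_nat n * L * h = 0"
  by (rule zero_if_zero_at_generic) (rule pencil_along_orbit(2))

end

section \<open>A kernel coordinate for orbit lines of variable direction\<close>

lemma degree_mult_bound: "degree p \<le> m \<Longrightarrow> degree q \<le> k \<Longrightarrow> degree (p * q) \<le> m + k"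
  by (rule le_trans[OF degree_mult_le]) simp

lemma coeff_mult_bound:
  assumes "degree p \<le> m" "degree q \<le> k"
  shows "coeff (p * q) (m + k) = coeff p m * coeff q k"
proof (cases "degree p = m \<and> degree q = k")
  case True
  then show ?thesis
    using coeff_mult_degree_sum[of p q] by auto
next
  case False
  then have "degree p < m \<or> degree q < k"
    using assms by auto
  moreover from this have "degree (p * q) < m + k"
    using assms degree_mult_le[of p q] by linarith
  ultimately show ?thesis
    by (auto simp: coeff_eq_0)
qed

lemma coeff_partial:
  "coeff (partial_x w) i = map_poly pderiv (coeff w i)"
  "coeff (partial_y w) i = pderiv (coeff w i)"
  "coeff (partial_z w) i = of_nat (Suc i) * coeff w (Suc i)"
  by (simp_all add: partial_x_def partial_y_def partial_z_def coeff_map_poly coeff_pderiv)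

lemma degree_partial:
  "degree (partial_x w) \<le> degree w" "degree (partial_y w) \<le> degree w"
  "degree (partial_z w) = degree (w :: 'k::field_char_0 poly3) - 1"
  by (simp_all add: partial_x_def partial_y_def partial_z_def map_poly_degree_leq degree_pderiv)

lemma degree_le_pred:
  assumes "degree p \<le> m" "coeff p m = 0" "m > 0"
  shows "degree p \<le> m - 1"
  using assms by (metis Suc_pred' degree_0 eq_zero_or_degree_less less_Suc_eq_le)

lemma (in nice_derivation) D_xy: "D [:w:] = f * [:map_poly pderiv w:] + g * [:pderiv w:]"
  using D_expand[of "[:w:]"]
  by (simp add: partial_x_def partial_y_def partial_z_def map_poly_pCons pderiv_pCons)

context independent_directions
begin

text \<open>
  The identity \<open>lead_coeffs_constant_along_orbits\<close> is a quadratic relation between \<open>f\<close> and \<open>g\<close> over \<open>k[x,y]\<close>; as \<open>f\<close> and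
  \<open>g\<close> are independent on a generic vertical line, it is trivial.
\<close>

lemma lead_coeffs_partial:
  "pderiv F = 0" "map_poly pderiv G = 0" "map_poly pderiv F = pderiv G"
proof -
  define \<alpha> \<beta> \<gamma> where "\<alpha> = pderiv F" and "\<beta> = map_poly pderiv F - pderiv G"
    and "\<gamma> = - map_poly pderiv G"
  have "g * (f * [:map_poly pderiv F:] + g * [:pderiv F:]) -
      f * (f * [:map_poly pderiv G:] + g * [:pderiv G:]) = 0"
    using lead_coeffs_constant_along_orbits unfolding D_xy .
  moreover have "[:\<beta>:] = [:map_poly pderiv F:] - [:pderiv G:]" "[:\<gamma>:] = - [:map_poly pderiv G:]"
    by (simp_all add: \<beta>_def \<gamma>_def)
  ultimately have q: "[:\<alpha>:] * (g * g) + [:\<beta>:] * (f * g) + [:\<gamma>:] * (f * f) = 0"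
    unfolding \<alpha>_def by algebra
  have pt: "ev p [:\<alpha>:] = 0 \<and> ev p [:\<beta>:] = 0 \<and> ev p [:\<gamma>:] = 0" if "ev p L \<noteq> 0" for p
  proof -
    obtain a b c0 where p: "p = (a, b, c0)"
      by (cases p)
    let ?f = "fibre a b f" and ?g = "fibre a b g"
    have L': "ev p g * ev2 a b F - ev p f * ev2 a b G \<noteq> 0"
      using that unfolding L_def ring_homo_diff[OF ring_homo_ev] ring_homo_mult[OF ring_homo_ev]
      by (simp add: p ev_const)
    have ncr: "\<not> (poly ?f e = 0 \<and> poly ?g e = 0)" for e
      using vertical_orbit[of a b e _ c0] D2x D2y L' unfolding ev_fibre[symmetric] p
      by (metis diff_self mult_zero_left)
    have "smult (ev2 a b \<alpha>) (?g * ?g) + smult (ev2 a b \<beta>) (?f * ?g) + smult (ev2 a b \<gamma>) (?f * ?f) = 0"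
    proof (rule poly_eq_of_values)
      fix c
      show "poly (smult (ev2 a b \<alpha>) (?g * ?g) + smult (ev2 a b \<beta>) (?f * ?g) +
          smult (ev2 a b \<gamma>) (?f * ?f)) c = poly 0 c"
        using arg_cong[OF q, of "ev (a, b, c)"]
        unfolding ring_homo_add[OF ring_homo_ev] ring_homo_mult[OF ring_homo_ev]
        by (simp add: ev_const ev_fibre[symmetric] ev_simps)
    qed
    then have "ev2 a b \<alpha> = 0 \<and> ev2 a b \<beta> = 0 \<and> ev2 a b \<gamma> = 0"
      by (rule pencil_quadratic_form[where n = n and ?c0.0 = c0, rotated -1])
        (use degree_fibre degree_fg ncr L' in \<open>auto simp: coeff_fibre p ev_fibre F_def G_def\<close>)
    then show ?thesis
      by (simp add: p ev_const)
  qed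
  have "[:\<alpha>:] = 0" "[:\<beta>:] = 0" "[:\<gamma>:] = 0"
    using pt ev_dense_0[OF L_nonzero] by blast+
  then show "pderiv F = 0" "map_poly pderiv G = 0" "map_poly pderiv F = pderiv G"
    by (auto simp: \<alpha>_def \<beta>_def \<gamma>_def)
qed

text \<open>
  So \<open>(F, G)\<close> is \<open>e (x, y)\<close> plus a constant.  If \<open>e\<close> were nonzero, then \<open>D g = 0\<close> would show
  that \<open>h\<close> has the leading term \<open>- (e / n) z\<^sup>n\<^sup>+\<^sup>1\<close>.  Hence \<open>D\<close> would map a polynomial with
  leading term \<open>\<kappa> z\<^sup>m\<close>, \<open>\<kappa>\<close> a constant, to one with leading term
  \<open>- (e / n) m \<kappa> z\<^sup>m\<^sup>+\<^sup>n\<close>, and it would not be nilpotent on \<open>z\<close>.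
\<close>

lemma lead_coeffs_constant: "map_poly pderiv F = 0" "pderiv G = 0"
proof -
  obtain F0 where F0: "F = [:F0:]"
    using lead_coeffs_partial(1) by (auto simp: pderiv_eq_0_iff elim: degree_eq_zeroE)
  have "map_poly pderiv F = [:pderiv F0:]"
    by (simp add: F0 map_poly_pCons)
  then have G': "pderiv G = [:pderiv F0:]"
    using lead_coeffs_partial(3) by simp
  have "pderiv (pderiv F0) = coeff (map_poly pderiv (pderiv G)) 0"
    by (simp add: G' map_poly_pCons)
  also have "map_poly pderiv (pderiv G) = pderiv (map_poly pderiv G)"
    by (intro poly_eqI)
      (simp add: coeff_map_poly coeff_pderiv pderiv_mult of_nat_poly pderiv_pCons del: of_nat_Suc)
  finally have "pderiv (pderiv F0) = 0"
    by (simp add: lead_coeffs_partial(2))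
  then obtain e where "pderiv F0 = [:e:]"
    by (auto simp: pderiv_eq_0_iff elim: degree_eq_zeroE)
  then have Gy: "pderiv G = [:[:e:]:]" and Fx: "map_poly pderiv F = [:[:e:]:]"
    using G' lead_coeffs_partial(3) by simp_all
  have "e = 0"
  proof (rule ccontr)
    assume e: "e \<noteq> 0"
    then have G0: "G \<noteq> 0"
      using Gy by auto
    then have dg: "degree g = n"
      using degree_fg le_degree[of g n] by (auto simp: G_def)
    have Dg: "partial_x g * f + partial_y g * g + partial_z g * h = 0"
      using D_expand[of g] D2y by simp
    have "degree (partial_x g * f + partial_y g * g) \<le> n + n"
      using degree_partial[of g] degree_fg dg
      by (intro degree_add_le degree_mult_bound) auto
    moreover have "partial_z g * h = - (partial_x g * f + partial_y g * g)"
      using Dg by algebra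
    ultimately have "degree (partial_z g * h) \<le> n + n"
      by (simp only: degree_minus)
    moreover have gz: "partial_z g \<noteq> 0" "degree (partial_z g) = n - 1"
      using dg n_pos by (auto simp: partial_z_def pderiv_eq_0_iff degree_pderiv)
    ultimately have dh: "degree h \<le> Suc n"
      by (cases "h = 0") (auto simp: degree_mult_eq)
    have "coeff (partial_z g * h) (n - 1 + Suc n) = of_nat n * G * coeff h (Suc n)"
      using coeff_mult_bound[of "partial_z g" "n - 1" h "Suc n"] gz dh n_pos
      by (simp add: coeff_partial G_def del: of_nat_Suc)
    moreover have "coeff (partial_x g * f) (n + n) = map_poly pderiv G * F"
      using coeff_mult_bound[of "partial_x g" n f n] degree_partial[of g] degree_fg dg
      by (simp add: coeff_partial G_def F_def)
    moreover have "coeff (partial_y g * g) (n + n) = pderiv G * G"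
      using coeff_mult_bound[of "partial_y g" n g n] degree_partial[of g] degree_fg dg
      by (simp add: coeff_partial G_def)
    moreover have "coeff (partial_x g * f + partial_y g * g + partial_z g * h) (n + n) = 0"
      by (simp add: Dg)
    moreover have "n - 1 + Suc n = n + n"
      using n_pos by simp
    ultimately have "G * ([:[:e:]:] + of_nat n * coeff h (Suc n)) = 0"
      using lead_coeffs_partial(2) Gy by (simp add: algebra_simps)
    then have "[:[:e:]:] + of_nat n * coeff h (Suc n) = 0"
      using G0 by simp
    then have "of_nat n * coeff h (Suc n) = of_nat n * [:[:- e / of_nat n:]:]"
      using n_pos by (simp add: of_nat_poly) (metis add_eq_0_iff minus_pCons minus_zero)
    then have hn: "coeff h (Suc n) = [:[:- e / of_nat n:]:]"
      using n_pos by (simp only: mult_cancel_left) simp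
    define grows where "grows w \<longleftrightarrow> (\<exists>m \<kappa>. m > 0 \<and> \<kappa> \<noteq> 0 \<and> degree w \<le> m \<and> coeff w m = [:[:\<kappa>:]:])"
      for w :: "'a poly3"
    have "grows (D w)" if "grows w" for w
    proof -
      obtain m \<kappa> where m: "m > 0" "\<kappa> \<noteq> 0" "degree w \<le> m" "coeff w m = [:[:\<kappa>:]:]"
        using \<open>grows w\<close> by (auto simp: grows_def)
      have dw: "degree (partial_x w) \<le> m" "degree (partial_y w) \<le> m" "degree (partial_z w) \<le> m - 1"
        using degree_partial[of w] m by auto
      have i: "m - 1 + Suc n = m + n"
        using m by simp
      have "degree (D w) \<le> m + n"
        unfolding D_expand[of w]
        using degree_mult_bound[OF dw(1) degree_fg(1)] degree_mult_bound[OF dw(2) degree_fg(2)]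
          degree_mult_bound[OF dw(3) dh]
        by (intro degree_add_le) (simp_all only: i)
      moreover have "coeff (partial_z w * h) (m - 1 + Suc n) = of_nat m * [:[:\<kappa>:]:] * [:[:- e / of_nat n:]:]"
        using coeff_mult_bound[OF dw(3) dh] m by (simp add: coeff_partial hn del: of_nat_Suc)
      then have "coeff (D w) (m + n) = of_nat m * [:[:\<kappa>:]:] * [:[:- e / of_nat n:]:]"
        unfolding D_expand[of w] i
        using coeff_mult_bound[OF dw(1) degree_fg(1)] coeff_mult_bound[OF dw(2) degree_fg(2)]
        by (simp add: coeff_partial m map_poly_pCons pderiv_pCons)
      then have "coeff (D w) (m + n) = [:[:of_nat m * \<kappa> * (- e / of_nat n):]:]"
        by (simp add: of_nat_poly)
      moreover have "of_nat m * \<kappa> * (- e / of_nat n) \<noteq> 0"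
        using m e n_pos by simp
      ultimately show ?thesis
        unfolding grows_def using m(1) by (meson trans_less_add1)
    qed
    moreover have "grows z3"
      unfolding grows_def z3_def
      by (intro exI[of _ 1]) (simp add: one_pCons)
    ultimately have "grows ((D ^^ k) z3)" for k
      by (induction k) auto
    moreover obtain k where "(D ^^ k) z3 = 0"
      using loc_nilp by (auto simp: locally_nilpotent_def)
    ultimately have "grows 0"
      by metis
    then show False
      by (auto simp: grows_def)
  qed
  then show "map_poly pderiv F = 0" "pderiv G = 0"
    using Fx Gy by simp_all
qed

lemma lead_coeffs_const3:
  obtains F1 G1 where "F = [:[:F1:]:]" "G = [:[:G1:]:]" "F1 \<noteq> 0 \<or> G1 \<noteq> 0"
proof -
  obtain F0 G0 where FG: "F = [:F0:]" "G = [:G0:]"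
    using lead_coeffs_partial(1) lead_coeffs_constant(2)
    by (auto simp: pderiv_eq_0_iff elim!: degree_eq_zeroE)
  then have "pderiv F0 = 0" "pderiv G0 = 0"
    using lead_coeffs_partial(2) lead_coeffs_constant(1) by (simp_all add: map_poly_pCons)
  then obtain F1 G1 where "F0 = [:F1:]" "G0 = [:G1:]"
    by (auto simp: pderiv_eq_0_iff elim!: degree_eq_zeroE)
  moreover have "F \<noteq> 0 \<or> G \<noteq> 0"
    using L_nonzero by (auto simp: L_def)
  ultimately show ?thesis
    using that FG by auto
qed

text \<open>
  Choose \<open>\<kappa> F + \<theta> G = 1\<close> and pass to \<open>f' = g F - f G\<close> of degree below \<open>n\<close> and
  \<open>g' = \<kappa> f + \<theta> g\<close>, monic of degree \<open>n\<close> with second coefficient \<open>v'\<close>.  The identity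
  \<open>translation_identity\<close> says that \<open>f' D(n z + v')\<close> is a multiple of \<open>g'\<close>; comparing degrees in \<open>z\<close> leaves only
  \<open>D(n z + v') = 0\<close>.
\<close>

lemma kernel_coordinate: "\<exists>w. D (z3 + [:w:]) = 0"
proof -
  obtain F1 G1 where FG: "F = [:[:F1:]:]" "G = [:[:G1:]:]" "F1 \<noteq> 0 \<or> G1 \<noteq> 0"
    by (rule lead_coeffs_const3)
  define \<kappa> \<theta> where "\<kappa> = (if F1 \<noteq> 0 then 1 / F1 else 0)" and "\<theta> = (if F1 \<noteq> 0 then 0 else 1 / G1)"
  have \<kappa>\<theta>: "\<kappa> * F1 + \<theta> * G1 = 1"
    using FG(3) by (auto simp: \<kappa>_def \<theta>_def)
  define F3 G3 K3 L3 :: "'a poly3"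
    where "F3 = [:F:]" and "G3 = [:G:]" and "K3 = const3 \<kappa>" and "L3 = const3 \<theta>"
  have unit: "K3 * F3 + L3 * G3 = 1"
    using \<kappa>\<theta> by (simp add: F3_def G3_def K3_def L3_def FG const3_def one_pCons mult.commute)
  define f' where "f' = g * F3 - f * G3"
  define g' where "g' = K3 * f + L3 * g"
  define u' where "u' = v * F - u * G"
  define v' where "v' = [:[:\<kappa>:]:] * u + [:[:\<theta>:]:] * v"
  define \<eta> where "\<eta> = of_nat n * h + D [:v':]"
  have f: "f = F3 * g' - L3 * f'" and g: "g = G3 * g' + K3 * f'"
    using unit unfolding f'_def g'_def by algebra+
  have DF3: "D F3 = 0" "D G3 = 0" "D K3 = 0" "D L3 = 0"
    using D_const3 by (simp_all add: F3_def G3_def K3_def L3_def FG const3_def)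
  have u'3: "[:u':] = [:v:] * F3 - [:u:] * G3"
    by (simp add: u'_def F3_def G3_def)
  have v'3: "[:v':] = K3 * [:u:] + L3 * [:v:]"
    by (simp add: v'_def K3_def L3_def const3_def)
  have Du': "D [:u':] = F3 * D [:v:] - G3 * D [:u:]"
    unfolding u'3 by (simp only: D_simps DF3) simp
  have Dv': "D [:v':] = K3 * D [:u:] + L3 * D [:v:]"
    unfolding v'3 by (simp only: D_simps DF3) simp
  have "g * D [:u:] - f * D [:v:] + of_nat n * f' * h = 0"
    using translation_identity by (simp only: L_def f'_def F3_def G3_def)
  then have "f' * \<eta> = g' * D [:u':]"
    using f g unfolding \<eta>_def Du' Dv' by algebra
  also have "D [:u':] = g' * (F3 * [:map_poly pderiv u':] + G3 * [:pderiv u':]) +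
      f' * (K3 * [:pderiv u':] - L3 * [:map_poly pderiv u':])"
    unfolding D_xy using f g by algebra
  finally obtain \<alpha> \<beta> where main: "f' * \<eta> = g' * (g' * [:\<alpha>:] + f' * [:\<beta>:])"
  proof -
    assume eq: "f' * \<eta> = g' * (g' * (F3 * [:map_poly pderiv u':] + G3 * [:pderiv u':]) +
      f' * (K3 * [:pderiv u':] - L3 * [:map_poly pderiv u':]))"
    have "F3 * [:map_poly pderiv u':] + G3 * [:pderiv u':] =
        [:F * map_poly pderiv u' + G * pderiv u':]"
      "K3 * [:pderiv u':] - L3 * [:map_poly pderiv u':] =
        [:[:[:\<kappa>:]:] * pderiv u' - [:[:\<theta>:]:] * map_poly pderiv u':]"
      by (simp_all add: F3_def G3_def K3_def L3_def const3_def)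
    then show ?thesis
      using eq that by metis
  qed

  have f'0: "f' \<noteq> 0"
    using L_nonzero by (simp add: L_def f'_def F3_def G3_def)
  have "degree f' \<le> n"
    unfolding f'_def using degree_fg
    by (intro degree_diff_le degree_mult_bound[where k = 0, simplified])
      (auto simp: F3_def G3_def)
  moreover have "coeff f' n = 0"
    by (simp add: f'_def F3_def G3_def F_def[symmetric] G_def[symmetric])
  ultimately have df': "degree f' \<le> n - 1"
    using n_pos by (intro degree_le_pred)
  have dg': "degree g' \<le> n"
    unfolding g'_def using degree_fg
    by (intro degree_add_le degree_mult_bound[where m = 0, simplified])
      (auto simp: K3_def L3_def const3_def)
  have cg': "coeff g' n = 1"
    using \<kappa>\<theta> unfolding g'_def K3_def L3_def const3_def
    by (simp add: F_def[symmetric] G_def[symmetric] FG one_pCons)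
  have cg'1: "coeff g' (n - 1) = v'"
    by (simp add: g'_def K3_def L3_def const3_def v'_def u_def v_def)

  have Dg': "partial_x g' * f + partial_y g' * g + partial_z g' * h = 0"
  proof -
    have "D g' = 0"
      unfolding g'_def by (simp add: D_simps DF3 D2x D2y)
    then show ?thesis
      using D_expand[of g'] by simp
  qed
  have gz: "degree (partial_z g') = n - 1" "partial_z g' \<noteq> 0"
  proof -
    have "degree g' = n"
      using dg' le_degree[of g' n] cg' by simp
    then show "degree (partial_z g') = n - 1" "partial_z g' \<noteq> 0"
      using n_pos by (auto simp: partial_z_def degree_pderiv pderiv_eq_0_iff)
  qed
  have "degree (partial_x g') \<le> n" "degree (partial_y g') \<le> n"
    using degree_partial[of g'] dg' by auto
  moreover have "coeff (partial_x g') n = 0" "coeff (partial_y g') n = 0"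
    using cg' by (simp_all add: coeff_partial map_poly_1)
  ultimately have dgx: "degree (partial_x g') \<le> n - 1" "degree (partial_y g') \<le> n - 1"
    using n_pos degree_le_pred by blast+
  have cgx: "coeff (partial_x g' * f) (n - 1 + n) = map_poly pderiv v' * F"
    "coeff (partial_y g' * g) (n - 1 + n) = pderiv v' * G"
    using coeff_mult_bound[OF dgx(1) degree_fg(1)] coeff_mult_bound[OF dgx(2) degree_fg(2)]
    by (simp_all add: coeff_partial cg'1[simplified] F_def G_def)
  have "degree (partial_x g' * f + partial_y g' * g) \<le> n - 1 + n"
    using dgx degree_fg by (intro degree_add_le degree_mult_bound)
  moreover have "partial_z g' * h = - (partial_x g' * f + partial_y g' * g)"
    using Dg' by algebra
  ultimately have "degree (partial_z g' * h) \<le> n - 1 + n"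
    by (simp only: degree_minus)
  then have dh: "degree h \<le> n"
    using gz by (cases "h = 0") (auto simp: degree_mult_eq)
  have "coeff (partial_z g' * h) (n - 1 + n) = of_nat n * coeff h n"
    using coeff_mult_bound[of "partial_z g'" "n - 1" h n] gz dh n_pos cg'
    by (simp add: coeff_partial del: of_nat_Suc)
  moreover have "coeff (partial_x g' * f + partial_y g' * g + partial_z g' * h) (n - 1 + n) = 0"
    by (simp add: Dg')
  ultimately have hn: "of_nat n * coeff h n + (map_poly pderiv v' * F + pderiv v' * G) = 0"
    unfolding coeff_add cgx by (simp add: algebra_simps)
  have "degree \<eta> \<le> n"
    unfolding \<eta>_def D_xy using dh degree_fg
    by (intro degree_add_le degree_mult_bound[where k = 0, simplified]
        degree_mult_bound[where m = 0, simplified]) auto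
  moreover have "coeff \<eta> n = 0"
    using hn unfolding \<eta>_def D_xy
    by (simp add: of_nat_poly F_def[symmetric] G_def[symmetric] algebra_simps)
  ultimately have d\<eta>: "degree \<eta> \<le> n - 1"
    using n_pos by (intro degree_le_pred)

  have "coeff (f' * \<eta>) (n + n) = 0"
    using degree_mult_bound[OF df' d\<eta>] n_pos by (intro coeff_eq_0) linarith
  moreover have "coeff (g' * (g' * [:\<alpha>:] + f' * [:\<beta>:])) (n + n) = \<alpha>"
  proof -
    have "degree (g' * [:\<alpha>:] + f' * [:\<beta>:]) \<le> n"
      using dg' df' by (intro degree_add_le degree_mult_bound[where k = 0, simplified]) auto
    moreover have "coeff (g' * [:\<alpha>:] + f' * [:\<beta>:]) n = \<alpha>"
      using df' n_pos cg' by (simp add: coeff_eq_0)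
    ultimately show ?thesis
      using coeff_mult_bound[OF dg', of "g' * [:\<alpha>:] + f' * [:\<beta>:]" n] cg' by simp
  qed
  ultimately have "\<alpha> = 0"
    using main by simp
  then have \<eta>: "\<eta> = g' * [:\<beta>:]"
  proof -
    have "f' * \<eta> = f' * (g' * [:\<beta>:])"
      using main \<open>\<alpha> = 0\<close> by (simp add: mult.commute)
    then show ?thesis
      using f'0 by (simp only: mult_cancel_left) simp
  qed
  have "coeff \<eta> n = \<beta>"
    unfolding \<eta> using cg' by simp
  then have "\<beta> = 0"
    using d\<eta> n_pos by (simp add: coeff_eq_0)
  then have D0: "of_nat n * h + D [:v':] = 0"
    using \<eta> by (simp add: \<eta>_def)
  define \<iota> where "\<iota> = 1 / (of_nat n :: 'a)"
  have "const3 \<iota> * (of_nat n * h + D [:v':]) = h + D (const3 \<iota> * [:v':])"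
  proof -
    have "const3 \<iota> * of_nat n = (1 :: 'a poly3)"
      using n_pos by (simp add: \<iota>_def const3_def of_nat_poly one_pCons)
    then have "const3 \<iota> * (of_nat n * h) = h"
      by (simp add: mult.assoc[symmetric])
    then show ?thesis
      by (simp add: D_simps D_const3 algebra_simps del: mult_pCons_right)
  qed
  then have "D (z3 + const3 \<iota> * [:v':]) = 0"
    using D0 unfolding derivation_add[OF der] by simp
  then show ?thesis
    by (intro exI[of _ "[:[:\<iota>:]:] * v'"]) (simp add: const3_def)
qed

end

section \<open>The kernel of a triangular derivation\<close>

text \<open>The embedding of \<open>k[x]\<close>; \<open>subst_y w\<close> below substitutes \<open>w\<close> for \<open>y\<close> in \<open>k[x,y]\<close>.\<close>

definition emb :: "'k::comm_ring_1 poly \<Rightarrow> 'k poly3" where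
  "emb r = [:[:r:]:]"

lemma ring_homo_emb: "ring_homo emb"
  unfolding emb_def by (rule ring_homo_comp[OF ring_homo_const_poly ring_homo_const_poly])

lemmas emb_simps = ring_homo_simps[OF ring_homo_emb]

lemma emb_eq_0: "emb r = 0 \<longleftrightarrow> r = 0"
  by (simp add: emb_def)

lemma ev_emb: "ev (a, b, c) (emb r) = poly r a"
  by (simp add: emb_def ev_const ev2_const)

definition specialize :: "'k::comm_ring_1 \<Rightarrow> 'k poly poly \<Rightarrow> 'k poly" where
  "specialize a = map_poly (\<lambda>r. poly r a)"

lemma poly_specialize: "poly (specialize a P) b = ev2 a b P"
  by (simp add: specialize_def ev2_def extend_def[abs_def])

lemma specialize_eq_0D:
  fixes P :: "'k::field poly poly"
  assumes "specialize a P = 0"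
  obtains Q where "P = smult [:- a, 1:] Q"
proof -
  have "[:- a, 1:] dvd coeff P i" for i
    using arg_cong[OF assms, of "\<lambda>Q. coeff Q i"]
    by (simp add: specialize_def coeff_map_poly poly_eq_0_iff_dvd[symmetric])
  then have "P = smult [:- a, 1:] (map_poly (\<lambda>r. r div [:- a, 1:]) P)"
    by (intro poly_eqI) (simp only: coeff_smult coeff_map_poly div_0 dvd_mult_div_cancel)
  then show ?thesis
    by (rule that)
qed

lemma specialize_all_0:
  fixes P :: "'k::{idom, ring_char_0} poly poly"
  assumes "\<And>a. specialize a P = 0"
  shows "P = 0"
  by (rule ev2_all_0) (simp add: poly_specialize[symmetric] assms)

definition subst_y :: "'k::comm_ring_1 poly3 \<Rightarrow> 'k poly poly \<Rightarrow> 'k poly3" where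
  "subst_y w = extend emb w"

lemma ring_homo_subst_y: "ring_homo (subst_y w)"
  unfolding subst_y_def by (rule ring_homo_extend[OF ring_homo_emb])

lemmas subst_y_simps = ring_homo_simps[OF ring_homo_subst_y]

lemma subst_y_const: "subst_y w [:r:] = emb r"
  by (simp add: subst_y_def extend_const ring_homo_emb)

lemma subst_y_var: "subst_y w [:0, 1:] = w"
  by (simp add: subst_y_def extend_var ring_homo_emb)

lemma subst_y_y3: "subst_y y3 P = [:P:]"
proof (rule ring_homo_poly_eqI[OF ring_homo_subst_y ring_homo_const_poly])
  show "subst_y y3 [:c:] = [:[:c:]:]" for c :: "'a poly"
    by (simp add: subst_y_const emb_def)
  show "subst_y y3 [:0, 1:] = [:[:0, 1:]:]"
    by (simp add: subst_y_var y3_def)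
qed

lemma ev_subst_y: "ev (a, b, c) (subst_y w P) = poly (specialize a P) (ev (a, b, c) w)"
  unfolding subst_y_def extend_comp[OF ring_homo_ev ring_homo_emb] ev_emb
  by (simp add: extend_def specialize_def)

locale triangular_derivation = nice_derivation +
  assumes Dx: "D x3 = 0"
begin

lemma D_triangular: "D b = partial_y b * g + partial_z b * h"
  using D_expand[of b] Dx by simp

lemma D_emb: "D (emb r) = 0"
  using D_xy[of "[:r:]"] by (simp add: emb_def Dx pderiv_pCons)

text \<open>
  A zero of \<open>g\<close> makes \<open>g\<close> vanish on the whole vertical line through it, so on each vertical
  line \<open>g\<close> is zero or without zeros, hence constant.
\<close>

lemma g_in_x: "\<exists>r. g = emb r"
proof -
  have "degree (fibre a b g) = 0" for a b
  proof (rule ccontr)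
    assume d: "degree (fibre a b g) \<noteq> 0"
    then obtain c0 where "poly (fibre a b g) c0 = 0"
      using alg_closed_imp_poly_has_root by blast
    then have "poly (fibre a b g) c = 0" for c
      using vertical_orbit[of a b c0 g c] Dx D2y by (simp add: ev_fibre ev_simps)
    then show False
      using d poly_all_0_iff_0 by (metis degree_0)
  qed
  then have "ev2 a b (coeff g i) = 0" if "i > 0" for a b i
    using that by (simp add: coeff_fibre[symmetric] coeff_eq_0)
  then have "coeff g i = 0" if "i > 0" for i
    using that by (intro ev2_all_0) auto
  then have "degree g = 0"
    by (metis leading_coeff_0_iff neq0_conv degree_0)
  then obtain g0 where g0: "g = [:g0:]"
    by (rule degree_eq_zeroE)
  have "g * [:pderiv g0:] = 0"
    using D_xy[of g0] D2y Dx by (simp add: g0)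
  then have "pderiv g0 = 0"
    using g0 by auto
  then obtain r where "g0 = [:r:]"
    by (auto simp: pderiv_eq_0_iff elim: degree_eq_zeroE)
  then show ?thesis
    using g0 by (auto simp: emb_def)
qed

text \<open>
  If \<open>h\<close> had positive degree in \<open>z\<close>, then \<open>D\<close> would map polynomials of positive degree in
  \<open>z\<close> to such polynomials: the leading term of \<open>h\<close> times the \<open>z\<close>-derivative cannot be
  cancelled by the \<open>y\<close>-derivative, whose coefficient has smaller degree in \<open>y\<close>.
\<close>

lemma h_in_xy:
  assumes g: "g = emb r"
  shows "\<exists>h0. h = [:h0:]"
proof -
  have "degree h = 0"
  proof (rule ccontr)
    assume "degree h \<noteq> 0"
    then obtain d where d: "degree h = Suc d"
      by (cases "degree h") auto
    define \<eta> where "\<eta> = coeff h (Suc d)"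
    have \<eta>: "\<eta> \<noteq> 0"
      using d unfolding \<eta>_def by (metis leading_coeff_0_iff degree_0 nat.distinct(1))
    have "degree (D w) > 0" if "degree w > 0" for w
    proof -
      obtain e where e: "degree w = Suc e"
        using \<open>degree w > 0\<close> by (cases "degree w") auto
      define \<beta> where "\<beta> = coeff w (Suc e)"
      have \<beta>: "\<beta> \<noteq> 0"
        using e unfolding \<beta>_def by (metis leading_coeff_0_iff degree_0 nat.distinct(1))
      define X where "X = coeff (partial_y w * g) (e + Suc d)"
      have dz: "degree (partial_z w) \<le> e"
        using degree_partial(3)[of w] e by simp
      have "coeff (partial_z w * h) (e + Suc d) = of_nat (Suc e) * \<beta> * \<eta>"
        using coeff_mult_bound[OF dz, of h "Suc d"] d
        by (simp add: coeff_partial \<beta>_def \<eta>_def del: of_nat_Suc)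
      then have c: "coeff (D w) (e + Suc d) = X + of_nat (Suc e) * \<beta> * \<eta>"
        by (simp add: D_triangular[of w] X_def del: of_nat_Suc)
      have X: "X = pderiv (coeff w (e + Suc d)) * [:r:]"
        by (simp add: X_def g emb_def coeff_partial mult.commute)
      have "X + of_nat (Suc e) * \<beta> * \<eta> \<noteq> 0"
      proof
        assume 0: "X + of_nat (Suc e) * \<beta> * \<eta> = 0"
        have "of_nat (Suc e) * \<beta> * \<eta> \<noteq> 0"
          using \<beta> \<eta> by (simp del: of_nat_Suc)
        then have "X \<noteq> 0"
          using 0 by auto
        then have nz: "pderiv (coeff w (e + Suc d)) \<noteq> 0" "[:r:] \<noteq> 0"
          unfolding X by auto
        then have "coeff w (e + Suc d) \<noteq> 0"
          by auto
        then have "e + Suc d \<le> Suc e"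
          using e le_degree by metis
        then have "d = 0"
          by simp
        then have X': "X = pderiv \<beta> * [:r:]" and "pderiv \<beta> \<noteq> 0"
          using X nz by (simp_all add: \<beta>_def)
        then have "degree X < degree \<beta>"
          using nz by (simp add: degree_mult_eq degree_pderiv pderiv_eq_0_iff)
        also have "degree \<beta> \<le> degree (of_nat (Suc e) * \<beta> * \<eta>)"
          using \<beta> \<eta> by (simp add: degree_mult_eq of_nat_poly del: of_nat_Suc)
        also have "of_nat (Suc e) * \<beta> * \<eta> = - X"
          using 0 by (metis add_eq_0_iff)
        finally show False
          by simp
      qed
      then have "e + Suc d \<le> degree (D w)"
        using c by (intro le_degree) simp
      then show ?thesis
        by simp
    qed
    moreover have "degree (z3 :: 'a poly3) > 0"
      by (simp add: z3_def)
    ultimately have "degree ((D ^^ m) z3) > 0" for m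
      by (induction m) auto
    moreover obtain m where "(D ^^ m) z3 = 0"
      using loc_nilp by (auto simp: locally_nilpotent_def)
    ultimately show False
      by (metis degree_0 less_irrefl)
  qed
  then show ?thesis
    by (auto elim: degree_eq_zeroE)
qed

text \<open>If \<open>g = 0\<close>, then \<open>D = h \<partial>/\<partial>z\<close> with \<open>h \<noteq> 0\<close>, so the kernel is \<open>k[x,y]\<close>.\<close>

lemma kernel_if_g_zero:
  assumes "g = 0" "D a = 0"
  shows "\<exists>P. a = subst_y y3 P"
proof -
  have "h \<noteq> 0"
  proof
    assume "h = 0"
    then have "D s = 0"
      using assms by (simp add: D_triangular[of s])
    then show False
      using slice by simp
  qed
  then have "pderiv a = 0"
    using assms D_triangular[of a] by (simp add: partial_z_def)
  then obtain P where "a = [:P:]"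
    by (auto simp: pderiv_eq_0_iff elim: degree_eq_zeroE)
  then show ?thesis
    by (auto simp: subst_y_y3)
qed

text \<open>
  Among the kernel elements \<open>r(x) z - H(x,y)\<close> with \<open>r \<noteq> 0\<close> one with \<open>r\<close> of least degree is
  nonconstant on every plane \<open>x = a\<close>: were it constant there, the constant could be subtracted
  and \<open>x - a\<close> divided out.  Being linear in \<open>z\<close> or a polynomial in \<open>y\<close> there, it takes all
  values.
\<close>

lemma least_linear_kernel_element:
  assumes g: "g = emb g1" "g1 \<noteq> 0"
  obtains r H where "r \<noteq> 0" "D (emb r * z3 - [:H:]) = 0"
    "\<And>a e. \<exists>b c. ev (a, b, c) (emb r * z3 - [:H:]) = e"
proof -
  define K where "K = (\<lambda>(r, H). r \<noteq> 0 \<and> D (emb r * z3 - [:H:]) = 0)"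
  obtain h0 where h0: "h = [:h0:]"
    using h_in_xy g by blast
  define \<iota> :: "nat \<Rightarrow> 'a poly" where "\<iota> n = [:1 / of_nat (Suc n):]" for n
  have "\<iota> n * of_nat (Suc n) = 1" for n
    by (simp add: \<iota>_def of_nat_poly one_pCons del: of_nat_Suc)
  then obtain H0 where "pderiv H0 = h0"
    using antiderivative_exists[of \<iota> h0] by blast
  then have "D (emb g1 * z3 - [:H0:]) = 0"
    by (simp add: D_simps D_emb D_xy Dx h0 g)
  then have "K (g1, H0)"
    using g by (simp add: K_def)
  then obtain p where p: "K p" "\<And>q. K q \<Longrightarrow> degree (fst p) \<le> degree (fst q)"
    using ex_has_least_nat[of K _ "\<lambda>p. degree (fst p)"] by blast
  obtain r H where rH: "p = (r, H)"
    by (cases p)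
  have r: "r \<noteq> 0" and D0: "D (emb r * z3 - [:H:]) = 0"
    using p(1) by (auto simp: K_def rH)
  have eval_w: "ev (a, b, c) (emb r * z3 - [:H:]) = poly r a * c - poly (specialize a H) b" for a b c
    by (simp add: ring_homo_diff[OF ring_homo_ev] ring_homo_mult[OF ring_homo_ev] ev_emb ev_gens
        ev_const poly_specialize)
  have "\<exists>b c. ev (a, b, c) (emb r * z3 - [:H:]) = e" for a e
  proof (cases "poly r a = 0")
    case False
    then have "ev (a, 0, (e + poly (specialize a H) 0) / poly r a) (emb r * z3 - [:H:]) = e"
      by (simp add: eval_w)
    then show ?thesis
      by blast
  next
    case True
    then obtain r' where r': "r = [:- a, 1:] * r'"
      by (auto simp: poly_eq_0_iff_dvd)
    have "degree (specialize a H) > 0"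
    proof (rule ccontr)
      assume "\<not> ?thesis"
      then obtain k where k: "specialize a H = [:k:]"
        by (auto elim: degree_eq_zeroE)
      have "specialize a (H - [:[:k:]:]) = 0"
      proof (rule poly_eq_of_values)
        fix b
        show "poly (specialize a (H - [:[:k:]:])) b = poly 0 b"
          using arg_cong[OF k, of "\<lambda>P. poly P b"]
          by (simp add: poly_specialize ring_homo_diff[OF ring_homo_ev2] ev2_const)
      qed
      then obtain H' where H': "H - [:[:k:]:] = smult [:- a, 1:] H'"
        by (rule specialize_eq_0D)
      have "[:H:] = emb [:- a, 1:] * [:H':] + const3 k"
        using H' by (simp add: emb_def const3_def algebra_simps)
      then have "emb r * z3 - [:H:] = emb [:- a, 1:] * (emb r' * z3 - [:H':]) - const3 k"
        unfolding r' ring_homo_mult[OF ring_homo_emb] by algebra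
      then have "emb [:- a, 1:] * D (emb r' * z3 - [:H':]) = 0"
        using D0 by (simp only: D_simps(5) D_simps(2)[of "emb [:- a, 1:]"] D_emb D_const3) simp
      then have "D (emb r' * z3 - [:H':]) = 0"
        using emb_eq_0[of "[:- a, 1:]"] by simp
      moreover have "r' \<noteq> 0"
        using r r' by auto
      ultimately have "degree r \<le> degree r'"
        using p(2)[of "(r', H')"] by (simp add: K_def rH)
      moreover have "degree r = Suc (degree r')"
        using \<open>r' \<noteq> 0\<close> unfolding r' by (subst degree_mult_eq) auto
      ultimately show False
        by simp
    qed
    then obtain b where "poly (specialize a H) b = - e"
      by (rule poly_surj_alg_closed)
    then have "ev (a, b, 0) (emb r * z3 - [:H:]) = e"
      by (simp add: eval_w)
    then show ?thesis
      by blast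
  qed
  then show ?thesis
    using that r D0 by blast
qed

text \<open>
  Up to denominators in \<open>k[x]\<close>, the kernel is \<open>k[x,w]\<close> for every kernel element \<open>w\<close> linear
  in \<open>z\<close>: the top coefficient in \<open>z\<close> of a kernel element lies in \<open>k[x]\<close>, so it can be
  cancelled by a power of \<open>w\<close>.
\<close>

lemma kernel_up_to_denominator:
  assumes g: "g = emb g1" "g1 \<noteq> 0"
    and w: "w = emb r * z3 - [:H:]" "r \<noteq> 0" "D w = 0"
    and a: "D a = 0"
  shows "\<exists>q P. q \<noteq> 0 \<and> emb q * a = subst_y w P"
  using a
proof (induction "degree a" arbitrary: a rule: less_induct)
  case less
  obtain h0 where h0: "h = [:h0:]"
    using h_in_xy g by blast
  define e where "e = degree a"
  have "coeff (partial_z a * h) e = 0"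
    by (simp add: h0 coeff_partial e_def coeff_eq_0)
  moreover have "coeff (partial_y a * g) e = pderiv (coeff a e) * [:g1:]"
    by (simp add: g emb_def coeff_partial mult.commute)
  ultimately have "pderiv (coeff a e) * [:g1:] = 0"
    using D_triangular[of a] less.prems by (metis add.right_neutral coeff_0 coeff_add)
  then have "pderiv (coeff a e) = 0"
    using g(2) by auto
  then obtain \<rho> where \<rho>: "coeff a e = [:\<rho>:]"
    by (auto simp: pderiv_eq_0_iff elim: degree_eq_zeroE)
  show ?case
  proof (cases "e = 0")
    case True
    then have "a = emb \<rho>"
      using \<rho> by (auto simp: emb_def e_def elim: degree_eq_zeroE)
    then have "emb 1 * a = subst_y w [:\<rho>:]"
      by (simp add: subst_y_const emb_simps)
    then show ?thesis
      by (metis one_neq_zero)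
  next
    case False
    define b where "b = emb (r ^ e) * a - emb \<rho> * w ^ e"
    have w': "w = [:- H, [:r:]:]"
      by (simp add: w emb_def z3_def)
    then have dw: "degree w = 1" "lead_coeff w = [:r:]"
      using w(2) by simp_all
    then have "w \<noteq> 0"
      by auto
    with dw have we: "degree (w ^ e) = e" "coeff (w ^ e) e = [:r ^ e:]"
      using degree_power_eq[of w e] lead_coeff_power[of w e]
      by (auto simp: poly_const_pow)
    have "degree b \<le> e"
      unfolding b_def emb_def using we
      by (intro degree_diff_le degree_mult_bound[where m = 0, simplified]) (auto simp: e_def)
    moreover have "coeff b e = 0"
      by (simp add: b_def emb_def \<rho> we)
    ultimately have "degree b < degree a"
      using False degree_le_pred[of b e] by (simp add: e_def)
    moreover have "D (w ^ m) = 0" for m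
      by (induction m) (simp_all add: D_simps w(3))
    then have "D b = 0"
      unfolding b_def using less.prems by (simp add: D_simps D_emb)
    ultimately obtain q P where q: "q \<noteq> 0" "emb q * b = subst_y w P"
      using less.hyps by blast
    have "emb (q * r ^ e) * a = emb q * b + emb (q * \<rho>) * w ^ e"
      by (simp add: b_def ring_homo_mult[OF ring_homo_emb] algebra_simps)
    also have "\<dots> = subst_y w (P + [:q * \<rho>:] * [:0, 1:] ^ e)"
      unfolding ring_homo_add[OF ring_homo_subst_y] ring_homo_mult[OF ring_homo_subst_y]
        ring_homo_power[OF ring_homo_subst_y] subst_y_const subst_y_var q(2) ..
    finally show ?thesis
      using q(1) w(2) by (metis mult_eq_0_iff power_not_zero)
  qed
qed

text \<open>
  As \<open>w\<close> takes every value on the plane \<open>x = \<alpha>\<close>, a polynomial in \<open>x\<close> and \<open>w\<close> that vanishes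
  there is divisible by \<open>x - \<alpha>\<close> already as a polynomial in two variables.
\<close>

lemma clear_denominator:
  fixes w :: "'a poly3"
  assumes surj: "\<And>a e. \<exists>b c. ev (a, b, c) w = e"
    and "q \<noteq> 0" "emb q * a = subst_y w P"
  shows "\<exists>P. a = subst_y w P"
  using assms(2,3)
proof (induction "degree q" arbitrary: q P)
  case 0
  then obtain k where k: "q = [:k:]" "k \<noteq> 0"
    by (metis degree_eq_zeroE pCons_0_0)
  have "emb [:1 / k:] * emb q = 1"
    using k by (simp add: emb_def one_pCons)
  then have "a = emb [:1 / k:] * (emb q * a)"
    by (simp only: mult.assoc[symmetric]) simp
  also have "\<dots> = subst_y w ([:[:1 / k:]:] * P)"
    unfolding ring_homo_mult[OF ring_homo_subst_y] subst_y_const 0(3) ..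
  finally show ?case
    by blast
next
  case (Suc m)
  then obtain \<alpha> where \<alpha>: "poly q \<alpha> = 0"
    using alg_closed_imp_poly_has_root[of q] by auto
  then obtain q' where q': "q = [:- \<alpha>, 1:] * q'"
    by (auto simp: poly_eq_0_iff_dvd)
  have "specialize \<alpha> P = 0"
  proof (rule poly_eq_of_values)
    fix e
    obtain b c where "ev (\<alpha>, b, c) w = e"
      using surj by blast
    then have "poly (specialize \<alpha> P) e = ev (\<alpha>, b, c) (emb q * a)"
      by (simp add: Suc.prems ev_subst_y)
    also have "\<dots> = 0"
      by (simp add: ring_homo_mult[OF ring_homo_ev] ev_emb \<alpha>)
    finally show "poly (specialize \<alpha> P) e = poly 0 e"
      by simp
  qed
  then obtain P' where P': "P = smult [:- \<alpha>, 1:] P'"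
    by (rule specialize_eq_0D)
  have "emb [:- \<alpha>, 1:] * (emb q' * a) = subst_y w ([:[:- \<alpha>, 1:]:] * P')"
  proof -
    have "emb q = emb [:- \<alpha>, 1:] * emb q'" "P = [:[:- \<alpha>, 1:]:] * P'"
      unfolding q' ring_homo_mult[OF ring_homo_emb] by (simp_all add: P')
    then show ?thesis
      using Suc.prems(2) by (simp only: mult.assoc)
  qed
  then have "emb [:- \<alpha>, 1:] * (emb q' * a) = emb [:- \<alpha>, 1:] * subst_y w P'"
    unfolding ring_homo_mult[OF ring_homo_subst_y] subst_y_const .
  then have "emb q' * a = subst_y w P'"
    using emb_eq_0[of "[:- \<alpha>, 1:]"] by (simp only: mult_cancel_left) simp
  moreover have "q' \<noteq> 0"
    using Suc.prems q' by auto
  moreover from this have "degree q = Suc (degree q')"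
    unfolding q' by (subst degree_mult_eq) auto
  ultimately show ?case
    using Suc.hyps by simp
qed

lemma subst_y_injective:
  fixes w :: "'a poly3"
  assumes surj: "\<And>a e. \<exists>b c. ev (a, b, c) w = e" and "subst_y w P = 0"
  shows "P = 0"
proof (rule specialize_all_0, rule poly_eq_of_values)
  fix a e
  obtain b c where "ev (a, b, c) w = e"
    using surj by blast
  then show "poly (specialize a P) e = poly 0 e"
    using assms(2) ev_subst_y[of a b c w P] by (simp add: ev_simps)
qed

lemma kernel_polynomial_ring:
  obtains w where "D w = 0" "\<And>a. D a = 0 \<Longrightarrow> \<exists>P. a = subst_y w P"
    "\<And>P. subst_y w P = 0 \<Longrightarrow> P = 0"
proof (cases "g = 0")
  case True
  show ?thesis
    by (rule that[of y3]) (use True kernel_if_g_zero in \<open>auto simp: subst_y_y3\<close>)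
next
  case False
  then obtain g1 where g: "g = emb g1" "g1 \<noteq> 0"
    using g_in_x emb_simps(4) by metis
  obtain r H where rH: "r \<noteq> 0" "D (emb r * z3 - [:H:]) = 0"
    "\<And>a e. \<exists>b c. ev (a, b, c) (emb r * z3 - [:H:]) = e"
    by (rule least_linear_kernel_element[OF g]) blast
  show ?thesis
  proof (rule that[OF rH(2)])
    fix a assume "D a = 0"
    then obtain q P where "q \<noteq> 0" "emb q * a = subst_y (emb r * z3 - [:H:]) P"
      using kernel_up_to_denominator[OF g refl rH(1,2)] by blast
    then show "\<exists>P. a = subst_y (emb r * z3 - [:H:]) P"
      by (rule clear_denominator[OF rH(3)])
  qed (rule subst_y_injective[OF rH(3)])
qed

end

section \<open>Straightening the derivation\<close>

lemma k_automorphismI: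
  assumes "ring_homo \<phi>" "\<And>c. \<phi> (const3 c) = const3 c" "bij \<phi>"
  shows "k_automorphism \<phi>"
  using assms by (simp add: k_automorphism_def ring_homo_def)

lemma k_automorphism_homo: "k_automorphism \<phi> \<Longrightarrow> ring_homo \<phi>"
proof -
  assume \<phi>: "k_automorphism \<phi>"
  then have "\<phi> (const3 1) = const3 1"
    by (simp add: k_automorphism_def)
  then have "\<phi> 1 = 1"
    unfolding ring_homo_1[OF ring_homo_const3] .
  then show "ring_homo \<phi>"
    using \<phi> by (simp add: k_automorphism_def ring_homo_def)
qed

lemma k_automorphism_inv:
  assumes "k_automorphism \<phi>"
  shows "k_automorphism (inv \<phi>)"
proof (rule k_automorphismI)
  have bij: "bij \<phi>" and c: "\<phi> (const3 c) = const3 c" for c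
    using assms by (auto simp: k_automorphism_def)
  show "ring_homo (inv \<phi>)" "bij (inv \<phi>)"
    using ring_homo_inv[OF k_automorphism_homo[OF assms] bij] bij_imp_bij_inv[OF bij] by auto
  show "inv \<phi> (const3 c) = const3 c" for c
    using inv_f_f[OF bij_is_inj[OF bij], of "const3 c"] c by simp
qed

lemma k_automorphism_comp:
  assumes "k_automorphism \<phi>" "k_automorphism \<psi>"
  shows "k_automorphism (\<phi> \<circ> \<psi>)"
  using assms by (auto simp: k_automorphism_def intro: bij_comp)

lemma k_automorphism_eval3:
  fixes a b c a' b' c' :: "'k::field poly3"
  assumes "eval3 const3 a' b' c' a = x3" "eval3 const3 a' b' c' b = y3" "eval3 const3 a' b' c' c = z3"
    and "eval3 const3 a b c a' = x3" "eval3 const3 a b c b' = y3" "eval3 const3 a b c c' = z3"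
  shows "k_automorphism (eval3 const3 a b c)"
proof -
  define \<theta> \<eta> where "\<theta> = eval3 const3 a b c" and "\<eta> = eval3 const3 a' b' c'"
  note inverse = assms[folded \<theta>_def \<eta>_def]
  have h: "ring_homo \<theta>" "ring_homo \<eta>"
    unfolding \<theta>_def \<eta>_def by (rule ring_homo_eval3[OF ring_homo_const3])+
  have gens: "\<theta> (const3 k) = const3 k" "\<theta> x3 = a" "\<theta> y3 = b" "\<theta> z3 = c"
    "\<eta> (const3 k) = const3 k" "\<eta> x3 = a'" "\<eta> y3 = b'" "\<eta> z3 = c'" for k
    by (simp_all add: \<theta>_def \<eta>_def eval3_gens ring_homo_const3)
  have "\<eta> (\<theta> p) = p" for p
    by (rule poly3_homo_eqI[OF ring_homo_comp[OF h(2,1)] ring_homo_id]) (simp_all add: gens inverse)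
  moreover have "\<theta> (\<eta> p) = p" for p
    by (rule poly3_homo_eqI[OF ring_homo_comp[OF h] ring_homo_id]) (simp_all add: gens inverse)
  ultimately have "bij \<theta>"
    by (intro o_bij[of \<eta>]) auto
  then have "k_automorphism \<theta>"
    using h gens by (intro k_automorphismI)
  then show ?thesis
    by (simp add: \<theta>_def)
qed

text \<open>
  Control of the image of the slice is what linearizes \<open>N s D\<close> together with \<open>D\<close>.
\<close>

definition straightens :: "('k::field poly3 \<Rightarrow> 'k poly3) \<Rightarrow> ('k poly3 \<Rightarrow> 'k poly3) \<Rightarrow> 'k poly3 \<Rightarrow> bool"
  where "straightens \<phi> D s \<longleftrightarrow>
    k_automorphism \<phi> \<and> \<phi> \<circ> D \<circ> inv \<phi> = partial_z \<and> \<phi> s = z3"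

lemma straightens_conj:
  assumes \<theta>: "k_automorphism \<theta>" and \<phi>: "straightens \<phi> (inv \<theta> \<circ> D \<circ> \<theta>) (inv \<theta> s)"
  shows "straightens (\<phi> \<circ> inv \<theta>) D s"
proof -
  have bij: "bij \<theta>" "bij \<phi>"
    using assms by (auto simp: k_automorphism_def straightens_def)
  have "inv (\<phi> \<circ> inv \<theta>) = \<theta> \<circ> inv \<phi>"
    using bij by (simp add: o_inv_distrib bij_imp_bij_inv inv_inv_eq)
  then show ?thesis
    using \<phi> k_automorphism_comp[OF _ k_automorphism_inv[OF \<theta>]]
    by (simp add: straightens_def o_assoc)
qed

context slice_derivation
begin

lemma slice_derivation_conj:
  assumes \<theta>: "k_automorphism \<theta>"
  shows "slice_derivation (inv \<theta> \<circ> D \<circ> \<theta>) (inv \<theta> s)"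
proof
  have bij: "bij \<theta>"
    using \<theta> by (simp add: k_automorphism_def)
  note h = k_automorphism_homo[OF \<theta>] k_automorphism_homo[OF k_automorphism_inv[OF \<theta>]]
  have c: "\<theta> (const3 c) = const3 c" for c
    using \<theta> by (simp add: k_automorphism_def)
  have i: "inv \<theta> (\<theta> b) = b" "\<theta> (inv \<theta> b) = b" for b
    using bij by (simp_all add: bij_is_inj bij_is_surj surj_f_inv_f)
  show "k_derivation (inv \<theta> \<circ> D \<circ> \<theta>)"
    by (simp add: k_derivation_def ring_homo_add[OF h(1)] ring_homo_add[OF h(2)]
        ring_homo_mult[OF h(1)] ring_homo_mult[OF h(2)] D_simps i c D_const3 ring_homo_0[OF h(2)])
  have pow: "((inv \<theta> \<circ> D \<circ> \<theta>) ^^ m) b = inv \<theta> ((D ^^ m) (\<theta> b))" for m b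
    by (induction m) (simp_all add: i)
  show "locally_nilpotent (inv \<theta> \<circ> D \<circ> \<theta>)"
    using loc_nilp unfolding locally_nilpotent_def pow by (metis ring_homo_0[OF h(2)])
  show "(inv \<theta> \<circ> D \<circ> \<theta>) (inv \<theta> s) = 1"
    by (simp add: i slice ring_homo_1[OF h(2)])
qed

end

lemma pderiv_map_poly: "ring_homo e \<Longrightarrow> pderiv (map_poly e P) = map_poly e (pderiv P)"
  by (intro poly_eqI)
    (simp add: coeff_pderiv coeff_map_poly ring_homo_0 ring_homo_mult ring_homo_of_nat
      del: of_nat_Suc)

context triangular_derivation
begin

text \<open>
  With \<open>k[x,w]\<close> as kernel, the substitution \<open>y \<mapsto> w\<close>, \<open>z \<mapsto> s\<close> is an automorphism by the
  slice theorem, and it carries \<open>\<partial>/\<partial>z\<close> to \<open>D\<close>.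
\<close>

lemma triangular_straightened: "\<exists>\<phi>. straightens \<phi> D s"
proof -
  obtain w where w: "D w = 0" "\<And>a. D a = 0 \<Longrightarrow> \<exists>P. a = subst_y w P"
    "\<And>P. subst_y w P = 0 \<Longrightarrow> P = 0"
    by (rule kernel_polynomial_ring) blast
  define \<psi> where "\<psi> = extend (subst_y w) s"
  have h: "ring_homo \<psi>"
    unfolding \<psi>_def by (rule ring_homo_extend[OF ring_homo_subst_y])
  have D_subst: "D (subst_y w P) = 0" for P
    by (induction P) (simp_all add: subst_y_def extend_0 extend_pCons ring_homo_emb D_simps D_emb w(1))
  have ok: "over_ker (map_poly (subst_y w) b)" for b
    by (simp add: over_ker_def coeff_map_poly subst_y_simps D_subst)
  have "inj \<psi>"
  proof (rule injI)
    fix a b assume "\<psi> a = \<psi> b"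
    then have "\<psi> (a - b) = 0"
      by (simp add: ring_homo_diff[OF h])
    then have 0: "map_poly (subst_y w) (a - b) = 0"
      by (intro slice_transcendental[OF ok]) (simp add: \<psi>_def extend_def)
    have "coeff (a - b) i = 0" for i
      using arg_cong[OF 0, of "\<lambda>P. coeff P i"]
      by (intro w(3)) (simp add: coeff_map_poly subst_y_simps)
    then have "a - b = 0"
      by (intro poly_eqI) simp
    then show "a = b"
      by simp
  qed
  moreover have "\<exists>a. \<psi> a = b" for b
  proof -
    have "\<exists>P. coeff (rep b) i = subst_y w P" for i
      using over_ker_rep[of b] w(2) by (simp add: over_ker_def)
    then obtain Q where Q: "coeff (rep b) i = subst_y w (Q i)" for i
      by metis
    define a where "a = Poly (map Q [0..<Suc (degree (rep b))])"
    have "map_poly (subst_y w) a = rep b"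
    proof (rule poly_eqI)
      fix i
      show "coeff (map_poly (subst_y w) a) i = coeff (rep b) i"
        by (cases "i \<le> degree (rep b)")
          (auto simp: coeff_map_poly subst_y_simps a_def nth_default_def Q[symmetric] coeff_eq_0
            simp del: upt_Suc)
    qed
    then have "\<psi> a = b"
      by (simp add: \<psi>_def extend_def poly_rep)
    then show ?thesis
      by blast
  qed
  ultimately have bij: "bij \<psi>"
    unfolding bij_def surj_def by metis
  have "\<psi> (const3 c) = const3 c" for c
    by (simp add: \<psi>_def const3_def extend_const ring_homo_subst_y subst_y_const emb_def)
  then have \<psi>: "k_automorphism \<psi>"
    using h bij by (intro k_automorphismI)
  have D\<psi>: "D (\<psi> b) = \<psi> (partial_z b)" for b
    using D_poly_slice[OF ok]
    by (simp add: \<psi>_def extend_def partial_z_def pderiv_map_poly ring_homo_subst_y)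
  have i: "inv \<psi> (\<psi> b) = b" for b
    using bij by (simp add: bij_is_inj)
  have "\<psi> z3 = s"
    by (simp add: \<psi>_def z3_def extend_var ring_homo_subst_y)
  then have "inv \<psi> s = z3"
    using i by metis
  moreover have "inv \<psi> \<circ> D \<circ> inv (inv \<psi>) = partial_z"
    using bij by (auto simp: inv_inv_eq D\<psi> i)
  ultimately show ?thesis
    unfolding straightens_def using k_automorphism_inv[OF \<psi>] by blast
qed

end

context slice_derivation
begin

text \<open>
  Whether \<open>f\<close> and \<open>g\<close> are dependent or not, the remaining task is to exhibit coordinates: all
  that is known about \<open>D\<close> is invariant under automorphisms.
\<close>

lemma straightened_of_coordinates:
  assumes \<theta>: "k_automorphism \<theta>" and D0: "D (\<theta> x3) = 0" and D2: "D (D (\<theta> y3)) = 0"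
  shows "\<exists>\<phi>. straightens \<phi> D s"
proof -
  let ?D = "inv \<theta> \<circ> D \<circ> \<theta>"
  have bij: "bij \<theta>"
    using \<theta> by (simp add: k_automorphism_def)
  have i: "\<theta> (inv \<theta> b) = b" for b
    using bij by (simp add: bij_is_surj surj_f_inv_f)
  note h = k_automorphism_homo[OF k_automorphism_inv[OF \<theta>]]
  interpret conj: slice_derivation ?D "inv \<theta> s"
    by (rule slice_derivation_conj[OF \<theta>])
  interpret conj: triangular_derivation ?D "inv \<theta> s"
  proof
    show "?D x3 = 0" "?D (?D x3) = 0" "?D (?D y3) = 0"
      using D0 D2 by (simp_all add: i ring_homo_0[OF h] ring_homo_0[OF k_automorphism_homo[OF \<theta>]] D_simps)
  qed
  obtain \<phi> where "straightens \<phi> ?D (inv \<theta> s)"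
    using conj.triangular_straightened by blast
  then show ?thesis
    using straightens_conj[OF \<theta>] by blast
qed

end

context nice_derivation
begin

lemma straightened_if_dependent:
  assumes "\<alpha> \<noteq> 0 \<or> \<beta> \<noteq> 0" and dep: "const3 \<alpha> * f + const3 \<beta> * g = 0"
  shows "\<exists>\<phi>. straightens \<phi> D s"
proof -
  note c = eval3_gens[OF ring_homo_const3] ring_homo_simps[OF ring_homo_eval3[OF ring_homo_const3]]
  show ?thesis
  proof (cases "\<alpha> = 0")
    case True
    have "const3 \<beta> \<noteq> 0"
      using assms True by (simp add: const3_def)
    then have "g = 0"
      using dep True by (simp add: ring_homo_0[OF ring_homo_const3])
    have "k_automorphism (eval3 const3 y3 x3 z3 :: 'a poly3 \<Rightarrow> _)"
      by (rule k_automorphism_eval3[where a' = y3 and b' = x3 and c' = z3]) (simp_all add: c)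
    then show ?thesis
      by (rule straightened_of_coordinates) (simp_all add: c \<open>g = 0\<close> D2x)
  next
    case False
    let ?x = "const3 \<alpha> * x3 + const3 \<beta> * y3 :: 'a poly3"
      and ?x' = "const3 (1 / \<alpha>) * (x3 - const3 \<beta> * y3) :: 'a poly3"
    have "const3 \<alpha> * const3 (1 / \<alpha>) = (1 :: 'a poly3)"
      using False by (simp add: const3_def one_pCons)
    then have inv: "const3 \<alpha> * (const3 (1 / \<alpha>) * b) = b" "const3 (1 / \<alpha>) * (const3 \<alpha> * b) = b"
      for b :: "'a poly3"
      by (simp_all only: mult.assoc[symmetric] mult.commute[of "const3 (1 / \<alpha>)" "const3 \<alpha>"] mult_1)
    have "k_automorphism (eval3 const3 ?x y3 z3)"
      by (rule k_automorphism_eval3[where a' = ?x' and b' = y3 and c' = z3]) (simp_all add: c inv)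
    then show ?thesis
      by (rule straightened_of_coordinates) (simp_all add: c D_simps D_const3 dep D2y)
  qed
qed

text \<open>
  The coordinates are \<open>z + v(x,y), y, x\<close>; the inverse substitution needs \<open>v\<close> with \<open>z\<close> in the
  place of \<open>x\<close>, which is \<open>\<eta>0 [:v:]\<close>.
\<close>

lemma straightened_if_kernel_coordinate:
  assumes "D (z3 + [:v:]) = 0"
  shows "\<exists>\<phi>. straightens \<phi> D s"
proof -
  note c = eval3_gens[OF ring_homo_const3] ring_homo_simps[OF ring_homo_eval3[OF ring_homo_const3]]
  note h = ring_homo_eval3[OF ring_homo_const3]
  define \<eta>0 where "\<eta>0 = eval3 const3 z3 y3 (0 :: 'a poly3)"
  define \<theta> where "\<theta> = eval3 const3 (z3 + [:v:]) y3 x3"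
  define \<eta> where "\<eta> = eval3 const3 z3 y3 (x3 - \<eta>0 [:v:])"
  have \<theta>v: "\<theta> (\<eta>0 [:v:]) = [:v:]"
    by (rule xy_homo_eqI[OF ring_homo_comp ring_homo_id]) (simp_all add: \<theta>_def \<eta>0_def h c)
  have \<eta>v: "\<eta> [:v:] = \<eta>0 [:v:]"
    by (rule xy_homo_eqI) (simp_all add: \<eta>_def \<eta>0_def h c)
  have "k_automorphism \<theta>"
    unfolding \<theta>_def
    by (rule k_automorphism_eval3[where a' = z3 and b' = y3 and c' = "x3 - \<eta>0 [:v:]"])
      (use \<theta>v \<eta>v in \<open>simp_all add: c \<theta>_def \<eta>_def\<close>)
  then show ?thesis
    by (rule straightened_of_coordinates) (simp_all add: \<theta>_def c assms D2y)
qed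

lemma straightened: "\<exists>\<phi>. straightens \<phi> D s"
proof (cases "\<exists>\<alpha> \<beta>. (\<alpha> \<noteq> 0 \<or> \<beta> \<noteq> 0) \<and> const3 \<alpha> * f + const3 \<beta> * g = 0")
  case True
  then show ?thesis
    using straightened_if_dependent by blast
next
  case False
  interpret independent_directions D s
    by standard (use False in blast)
  show ?thesis
    using kernel_coordinate straightened_if_kernel_coordinate by blast
qed

end

section \<open>The action of the multiplicative group\<close>

context slice_derivation
begin

definition scale :: "'k \<Rightarrow> 'k poly3 \<Rightarrow> 'k poly3" where
  "scale \<tau> b = poly (rep b) (const3 \<tau> * s)"

lemma slice_action_eq_scale: "slice_action D s N t = scale (t powi N)"
  by (rule ext) (simp add: slice_action_def scale_def rep_def over_ker_def)

lemma ring_homo_scale: "ring_homo (scale \<tau>)"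
  unfolding scale_def by (rule ring_homo_comp[OF ring_homo_poly ring_homo_rep])

lemma scale_ker: "D a = 0 \<Longrightarrow> scale \<tau> a = a"
  by (simp add: scale_def rep_ker)

lemma scale_slice: "scale \<tau> s = const3 \<tau> * s"
  by (simp add: scale_def rep_slice)

lemma scale_scale: "scale \<tau> (scale \<sigma> b) = scale (\<tau> * \<sigma>) b"
proof -
  have "scale \<tau> (const3 \<sigma> * s) = const3 \<sigma> * (const3 \<tau> * s)"
    by (simp add: ring_homo_mult[OF ring_homo_scale] scale_ker D_const3 scale_slice)
  then have *: "scale \<tau> (const3 \<sigma> * s) = const3 (\<tau> * \<sigma>) * s"
    by (simp add: ring_homo_mult[OF ring_homo_const3] mult_ac)
  have "scale \<tau> (scale \<sigma> b) = extend (scale \<tau>) (const3 (\<tau> * \<sigma>) * s) (rep b)"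
    unfolding scale_def[of \<sigma>] ring_homo_apply_poly[OF ring_homo_scale] * ..
  also have "\<dots> = extend (\<lambda>a. a) (const3 (\<tau> * \<sigma>) * s) (rep b)"
    using over_ker_rep[of b] by (intro extend_cong) (simp add: over_ker_def scale_ker)
  finally show ?thesis
    by (simp add: scale_def extend_def)
qed

lemma scale_1: "scale 1 b = b"
  by (simp add: scale_def ring_homo_1[OF ring_homo_const3] poly_rep)

lemma k_automorphism_scale:
  assumes "\<tau> \<noteq> 0"
  shows "k_automorphism (scale \<tau>)"
proof (rule k_automorphismI[OF ring_homo_scale])
  show "scale \<tau> (const3 c) = const3 c" for c
    by (simp add: scale_ker D_const3)
  show "bij (scale \<tau>)"
    using assms by (intro o_bij[of "scale (1 / \<tau>)"]) (auto simp: scale_scale scale_1)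
qed

text \<open>The operator \<open>s D\<close> is the Euler derivation of the graded ring \<open>A[s]\<close>.\<close>

lemma euler_slice: "s * D b = (\<Sum>i\<le>degree (rep b). of_nat i * (coeff (rep b) i * s ^ i))"
proof -
  define R where "R = pCons 0 (pderiv (rep b))"
  have c: "coeff R i = of_nat i * coeff (rep b) i" for i
    by (cases i) (simp_all add: R_def coeff_pderiv)
  have "s * D b = poly R s"
    using D_poly_slice[OF over_ker_rep[of b]] by (simp add: R_def poly_rep)
  also have "degree R \<le> degree (rep b)"
    by (intro degree_le) (simp add: c coeff_eq_0)
  then have "poly R s = (\<Sum>i\<le>degree (rep b). coeff R i * s ^ i)"
    unfolding poly_altdef by (intro sum.mono_neutral_left) (auto simp: coeff_eq_0)
  finally show ?thesis
    by (simp add: c mult.assoc)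
qed

lemma Gm_action_slice_action:
  assumes N: "N \<noteq> 0"
  shows "Gm_action_of_derivation (slice_action D s N) (\<lambda>b. of_int N * s * D b)"
  unfolding Gm_action_of_derivation_def slice_action_eq_scale
proof (intro conjI allI impI)
  show "k_automorphism (scale (t powi N))" if "t \<noteq> 0" for t
    using that by (intro k_automorphism_scale) simp
  show "scale ((t * u) powi N) = scale (t powi N) \<circ> scale (u powi N)" for t u
    by (auto simp: scale_scale power_int_mult_distrib)
  fix b
  define F where "F = (\<lambda>i. N * int i) ` {..degree (rep b)}"
  define c where "c m = coeff (rep b) (nat (m div N)) * s ^ nat (m div N)" for m
  have c: "c (N * int i) = coeff (rep b) i * s ^ i" for i
    using N by (simp add: c_def)
  have sum: "(\<Sum>m\<in>F. e m * c m) = (\<Sum>i\<le>degree (rep b). e (N * int i) * (coeff (rep b) i * s ^ i))"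
    for e :: "int \<Rightarrow> 'k poly3"
    unfolding F_def using N by (subst sum.reindex) (auto simp: inj_on_def c)
  have "scale (t powi N) b = (\<Sum>m\<in>F. const3 (t powi m) * c m)" for t
  proof -
    have "scale (t powi N) b = (\<Sum>i\<le>degree (rep b). coeff (rep b) i * (const3 (t powi N) * s) ^ i)"
      by (simp add: scale_def poly_altdef)
    moreover have "const3 (t powi (N * int i)) = const3 (t powi N) ^ i" for i
      by (simp add: power_int_mult ring_homo_power[OF ring_homo_const3])
    ultimately show ?thesis
      unfolding sum by (simp add: power_mult_distrib mult_ac)
  qed
  moreover have "of_int N * s * D b = (\<Sum>m\<in>F. of_int m * c m)"
    unfolding sum mult.assoc euler_slice by (simp add: sum_distrib_left mult_ac)
  moreover have "finite F"
    by (simp add: F_def)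
  ultimately show "\<exists>F c. finite F \<and> (\<forall>t. t \<noteq> 0 \<longrightarrow> scale (t powi N) b = (\<Sum>n\<in>F. const3 (t powi n) * c n)) \<and>
      of_int N * s * D b = (\<Sum>n\<in>F. of_int n * c n)"
    by blast
qed

end

lemma ring_homo_of_int: "ring_homo h \<Longrightarrow> h (of_int m) = of_int m"
  by (cases m) (simp_all add: ring_homo_of_nat ring_homo_minus ring_homo_diff ring_homo_1)

lemma diagonal_of_straightens:
  assumes "straightens \<phi> D s"
  shows "\<phi> \<circ> (\<lambda>b. of_int N * s * D b) \<circ> inv \<phi> = diagonal_derivation 0 0 (of_int N)"
proof
  fix b
  have \<phi>: "k_automorphism \<phi>" and conj: "\<phi> (D (inv \<phi> b)) = partial_z b" and s: "\<phi> s = z3"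
    using assms by (auto simp: straightens_def fun_eq_iff)
  show "(\<phi> \<circ> (\<lambda>b. of_int N * s * D b) \<circ> inv \<phi>) b = diagonal_derivation 0 0 (of_int N) b"
    using ring_homo_mult[OF k_automorphism_homo[OF \<phi>]] ring_homo_of_int[OF k_automorphism_homo[OF \<phi>]]
    by (simp add: diagonal_derivation_def conj s ring_homo_of_int[OF ring_homo_const3]
        ring_homo_0[OF ring_homo_const3])
qed

theorem corollary6p8:
  fixes D :: "'k::{alg_closed_field, field_char_0} poly3 \<Rightarrow> 'k poly3"
    and s :: "'k poly3"
    and N :: int
  assumes "k_derivation D"
    and "locally_nilpotent D"
    and "irreducible_derivation D"
    and "D (D x3) = 0"
    and "D (D y3) = 0"
    and "D s = 1"
    and "N \<noteq> 0"
  shows "conjugate_derivations D partial_z \<and>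
    linearizable_Gm_action (slice_action D s N) (\<lambda>b. of_int N * s * D b)"
proof -
  interpret nice_derivation D s
    by standard (use assms in auto)
  obtain \<phi> where \<phi>: "straightens \<phi> D s"
    using straightened by blast
  then have "conjugate_derivations D partial_z"
    by (auto simp: conjugate_derivations_def straightens_def)
  moreover have "conjugate_derivations (\<lambda>b. of_int N * s * D b) (diagonal_derivation 0 0 (of_int N))"
    using \<phi> diagonal_of_straightens[OF \<phi>]
    unfolding conjugate_derivations_def straightens_def by blast
  ultimately show ?thesis
    using Gm_action_slice_action[OF assms(7)] by (auto simp: linearizable_Gm_action_def)
qed

end
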